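(* Let $\mathbf X=(X(\mathbf t),\ \mathbf t\in T)$ be a centered real-valued Gaussian random field with continuous sample paths on a compact set $T\subset\mathbb R^d$, with covariance function $R_{\mathbf X}$. Let $K_1,K_2$ be nonempty compact subsets of $T$, let $r>0$, and let $$D_{K_1,K_2}(r)=\inf\bigl\{E(H^2):\ H\in\mathcal L\ \text{such that}\ E(X(\mathbf t)H)\ge 1\ \text{for each }\mathbf t\in K_1\ \text{and}\ E(X(\mathbf t)H)\le r\ \text{for each }\mathbf t\in K_2\bigr\}.$$ (a) If the feasible set in this optimization problem is not empty, then the infimum is achieved, at a unique $H\in\mathcal L$. (b) The following holds true: $$D_{K_1,K_2}(r)=\left\{\min\left[\ \min_{\mu_1\in M_1^+(K_1)}\int_{K_1}\int_{K_1}R_{\mathbf X}(\mathbf t_1,\mathbf t_2)\,\mu_1(d\mathbf t_1)\mu_1(d\mathbf t_2),\ \ \min_{\substack{\mu_1\in M_1^+(K_1),\ \mu_2\in M_1^+(K_2)\\ \text{subject to }( * )}}\frac{A_{K_1,K_2}(\mu_1,\mu_2)}{B_{K_1,K_2}(\mu_1,\mu_2;r)}\ \right]\right\}^{-1},$$ with $$A_{K_1,K_2}(\mu_1,\mu_2)=\int_{K_1}\int_{K_1}R_{\mathbf X}(\mathbf t_1,\mathbf t_2)\,\mu_1(d\mathbf t_1)\mu_1(d\mathbf t_2)\int_{K_2}\int_{K_2}R_{\mathbf X}(\mathbf t_1,\mathbf t_2)\,\mu_2(d\mathbf t_1)\mu_2(d\mathbf t_2)-\left(\int_{K_1}\int_{K_2}R_{\mathbf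 X}(\mathbf t_1,\mathbf t_2)\,\mu_1(d\mathbf t_1)\mu_2(d\mathbf t_2)\right)^2,$$ $$B_{K_1,K_2}(\mu_1,\mu_2;r)=r^2\int_{K_1}\int_{K_1}R_{\mathbf X}(\mathbf t_1,\mathbf t_2)\,\mu_1(d\mathbf t_1)\mu_1(d\mathbf t_2)-2r\int_{K_1}\int_{K_2}R_{\mathbf X}(\mathbf t_1,\mathbf t_2)\,\mu_1(d\mathbf t_1)\mu_2(d\mathbf t_2)+\int_{K_2}\int_{K_2}R_{\mathbf X}(\mathbf t_1,\mathbf t_2)\,\mu_2(d\mathbf t_1)\mu_2(d\mathbf t_2),$$ and the condition $( * )$ in the second minimization problem is $$\int_{K_1}\int_{K_2}R_{\mathbf X}(\mathbf t_1,\mathbf t_2)\,\mu_1(d\mathbf t_1)\mu_2(d\mathbf t_2)\ \ge\ r\int_{K_1}\int_{K_1}R_{\mathbf X}(\mathbf t_1,\mathbf t_2)\,\mu_1(d\mathbf t_1)\mu_1(d\mathbf t_2).\qquad( * )$$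
   Context: $R_{\mathbf X}(\mathbf s,\mathbf t)=\mathrm{cov}(X(\mathbf s),X(\mathbf t))$. $\mathcal L$ denotes the closure in the mean square norm of the space of finite linear combinations $\sum_{j=1}^k a_jX(\mathbf t_j)$, with $a_j\in\mathbb R$, $\mathbf t_j\in T$ for $j=1,\ldots,k$, $k=1,2,\ldots$. $M_1^+(K)$ is the set of Borel probability measures on the compact set $K$.
   Formalization: The quotient A/B is taken only over pairs satisfying ( * ) with B nonzero, since B=0 gives 0/0, and the second minimum is an infimum, proved attained when pairs satisfying ( * ) exist and B is nonzero on all of them; otherwise it can fail to be attained. *)

theory Defs
  imports "HOL-Probability.Probability"
begin

(* A point mass counts as a (degenerate) normal law, so that fields with a singular
   covariance are included. *)
definition gaussian_rv :: "'a measure \<Rightarrow> ('a \<Rightarrow> real) \<Rightarrow> bool" where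
  "gaussian_rv M Y \<longleftrightarrow>
     Y \<in> borel_measurable M \<and>
     ((\<exists>m s. 0 < s \<and> distributed M lborel Y (normal_density m s)) \<or>
      (\<exists>m. AE \<omega> in M. Y \<omega> = m))"

definition finite_combinations :: "'t set \<Rightarrow> ('t \<Rightarrow> 'a \<Rightarrow> real) \<Rightarrow> ('a \<Rightarrow> real) set" where
  "finite_combinations T X =
     {(\<lambda>\<omega>. \<Sum>j=1..k. a j * X (t j) \<omega>) | (k::nat) (a :: nat \<Rightarrow> real) (t :: nat \<Rightarrow> 't).
        1 \<le> k \<and> (\<forall>j\<in>{1..k}. t j \<in> T)}"

(* Joint normality of all finite-dimensional distributions, in the form that every finite
   linear combination is normal. *)
definition gaussian_field :: "'a measure \<Rightarrow> 't set \<Rightarrow> ('t \<Rightarrow> 'a \<Rightarrow> real) \<Rightarrow> bool" where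
  "gaussian_field M T X \<longleftrightarrow> (\<forall>Y\<in>finite_combinations T X. gaussian_rv M Y)"

definition covariance :: "'a measure \<Rightarrow> ('a \<Rightarrow> real) \<Rightarrow> ('a \<Rightarrow> real) \<Rightarrow> real" where
  "covariance M Y Z =
     (\<integral>\<omega>. (Y \<omega> - (\<integral>\<omega>'. Y \<omega>' \<partial>M)) * (Z \<omega> - (\<integral>\<omega>'. Z \<omega>' \<partial>M)) \<partial>M)"

definition cov_fun :: "'a measure \<Rightarrow> ('t \<Rightarrow> 'a \<Rightarrow> real) \<Rightarrow> 't \<Rightarrow> 't \<Rightarrow> real" where
  "cov_fun M X s t = covariance M (X s) (X t)"

(* Elements are square-integrable functions, not equivalence classes: the set is closed under
   almost sure modification, and uniqueness in it means almost sure uniqueness. *)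
definition ms_closure :: "'a measure \<Rightarrow> 't set \<Rightarrow> ('t \<Rightarrow> 'a \<Rightarrow> real) \<Rightarrow> ('a \<Rightarrow> real) set" where
  "ms_closure M T X =
     {H \<in> borel_measurable M. integrable M (\<lambda>\<omega>. (H \<omega>)\<^sup>2) \<and>
        (\<forall>\<epsilon>>0. \<exists>Y\<in>finite_combinations T X. (\<integral>\<omega>. (H \<omega> - Y \<omega>)\<^sup>2 \<partial>M) < \<epsilon>)}"

definition feasible ::
  "'a measure \<Rightarrow> 't set \<Rightarrow> ('t \<Rightarrow> 'a \<Rightarrow> real) \<Rightarrow> 't set \<Rightarrow> 't set \<Rightarrow> real \<Rightarrow> ('a \<Rightarrow> real) set" where
  "feasible M T X K1 K2 r =
     {H \<in> ms_closure M T X.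
        (\<forall>t\<in>K1. (\<integral>\<omega>. X t \<omega> * H \<omega> \<partial>M) \<ge> 1) \<and>
        (\<forall>t\<in>K2. (\<integral>\<omega>. X t \<omega> * H \<omega> \<partial>M) \<le> r)}"

(* Extended-real valued: the value is infinite if there is no feasible H. *)
definition D_value ::
  "'a measure \<Rightarrow> 't set \<Rightarrow> ('t \<Rightarrow> 'a \<Rightarrow> real) \<Rightarrow> 't set \<Rightarrow> 't set \<Rightarrow> real \<Rightarrow> ereal" where
  "D_value M T X K1 K2 r = (INF H\<in>feasible M T X K1 K2 r. ereal (\<integral>\<omega>. (H \<omega>)\<^sup>2 \<partial>M))"

definition borel_probs :: "'t::topological_space set \<Rightarrow> 't measure set" where
  "borel_probs K = {\<mu>. sets \<mu> = sets (restrict_space borel K) \<and> prob_space \<mu>}"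

definition dbl_int :: "('t \<Rightarrow> 't \<Rightarrow> real) \<Rightarrow> 't measure \<Rightarrow> 't measure \<Rightarrow> real" where
  "dbl_int R \<mu> \<nu> = (\<integral>t\<^sub>1. (\<integral>t\<^sub>2. R t\<^sub>1 t\<^sub>2 \<partial>\<nu>) \<partial>\<mu>)"

definition A_term :: "('t \<Rightarrow> 't \<Rightarrow> real) \<Rightarrow> 't measure \<Rightarrow> 't measure \<Rightarrow> real" where
  "A_term R \<mu>\<^sub>1 \<mu>\<^sub>2 = dbl_int R \<mu>\<^sub>1 \<mu>\<^sub>1 * dbl_int R \<mu>\<^sub>2 \<mu>\<^sub>2 - (dbl_int R \<mu>\<^sub>1 \<mu>\<^sub>2)\<^sup>2"

definition B_term :: "('t \<Rightarrow> 't \<Rightarrow> real) \<Rightarrow> 't measure \<Rightarrow> 't measure \<Rightarrow> real \<Rightarrow> real" where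
  "B_term R \<mu>\<^sub>1 \<mu>\<^sub>2 r =
     r\<^sup>2 * dbl_int R \<mu>\<^sub>1 \<mu>\<^sub>1 - 2 * r * dbl_int R \<mu>\<^sub>1 \<mu>\<^sub>2 + dbl_int R \<mu>\<^sub>2 \<mu>\<^sub>2"

definition admissible_pairs ::
  "('t::topological_space \<Rightarrow> 't \<Rightarrow> real) \<Rightarrow> 't set \<Rightarrow> 't set \<Rightarrow> real \<Rightarrow> ('t measure \<times> 't measure) set"
where
  "admissible_pairs R K1 K2 r =
     {(\<mu>\<^sub>1, \<mu>\<^sub>2). \<mu>\<^sub>1 \<in> borel_probs K1 \<and> \<mu>\<^sub>2 \<in> borel_probs K2 \<and>
        dbl_int R \<mu>\<^sub>1 \<mu>\<^sub>2 \<ge> r * dbl_int R \<mu>\<^sub>1 \<mu>\<^sub>1}"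

(* For a centered field B is the variance of
   r * (integral of X against mu1) - (integral of X against mu2), so B = 0 forces A = 0 and A / B
   becomes 0 / 0, which HOL evaluates to 0.  The quotient is therefore taken only over the
   admissible pairs with nonzero B.  Its infimum over these need not be attained if there are
   admissible pairs with B = 0: for independent standard normal z0, z1, z2 let
     X(t) = z0 + z1 + sin t * z1 + (1 - cos t) * z2,  T = K2 = [0, pi/2],  K1 = {0},  r = 1.
   Then D = 1, the first minimum is 2, and A / B > 1 at every pair with B nonzero, with
   A / B tending to 1 for point masses at t, t -> 0.  No fixed value for 0 / 0 repairs this:
   here it would have to be 1, less than the variance 2 of X(0), whereas for K1 = K2 = {t},
   r = 1 it has to be at least the variance of X(t). *)
definition nondegenerate_pairs ::
  "('t::topological_space \<Rightarrow> 't \<Rightarrow> real) \<Rightarrow> 't set \<Rightarrow> 't set \<Rightarrow> real \<Rightarrow> ('t measure \<times> 't measure) set"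
where
  "nondegenerate_pairs R K1 K2 r =
     {(\<mu>\<^sub>1, \<mu>\<^sub>2) \<in> admissible_pairs R K1 K2 r. B_term R \<mu>\<^sub>1 \<mu>\<^sub>2 r \<noteq> 0}"

end

(*
For a feasible H, a probability measure mu1 on K1, mu2 on K2 and q >= 0, pairing H with
V = (1 + q r) int X dmu1 - q int X dmu2 gives at least (1 + q r) - q r = 1, so that
E(H^2) E(V^2) >= 1 by Cauchy-Schwarz.  The variance of V is a quadratic in q,
  a + 2 q (r a - b) + q^2 B,   a = var(int X dmu1),  b = cov(int X dmu1, int X dmu2),
whose minimum over q >= 0 is a if b <= r a, and A / B otherwise; hence the two minimization
problems.  Conversely, if V* is the element of least norm in the closed convex hull of these V,
then <V, V*> >= |V*|^2 for all V, and H = V* / |V*|^2 is feasible with E(H^2) = 1 / |V*|^2; the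
bound on K2 comes from letting q tend to infinity and from <V*, H> = 1.

General measures enter the duality only through the kernel |H|^2 R(s,t) - h(s) h(t) with
h(t) = E(X(t) H): it is positive semidefinite and continuous, and stays so under integration by
weak approximation with finitely supported measures.  Continuity of R follows from the
characteristic function, E cos(X(s) - X(t)) = exp(-var(X(s) - X(t)) / 2), by dominated convergence.
*)
theory Submission
  imports Defs
begin

section \<open>Square-integrable functions\<close>

text \<open>The integral of \<open>X\<close> against a general measure is never built as a random
  variable: only the numbers \<open>dbl_int R \<mu> \<nu>\<close> occur, which avoids questions of
  joint measurability. The convex set whose least-norm element is sought is accordingly generated by
  finitely supported measures, where the integrals are plain sums; general measures enter through
  inequalities and limits of double integrals. The multiplier \<open>q\<close> ranges over an
  unbounded set, so weak compactness of the probability measures does not by itself give a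
  least-norm \<open>V\<close>; the minimum is located in the Hilbert space, by completeness of L2.
  It is a limit and need not come from any measures and any \<open>q\<close>, so its inner products
  are controlled through the approximating sums. Weak compactness serves the attainment of the two
  minima in the formula. Leaving out pairs with B = 0 costs nothing in the duality: there the linear
  term in \<open>q\<close> vanishes as well, the quadratic is constantly a, and the first minimum
  covers it.\<close>

definition L2 :: "'a measure \<Rightarrow> ('a \<Rightarrow> real) set" where
  "L2 M = {f \<in> borel_measurable M. integrable M (\<lambda>x. (f x)\<^sup>2)}"

definition ip :: "'a measure \<Rightarrow> ('a \<Rightarrow> real) \<Rightarrow> ('a \<Rightarrow> real) \<Rightarrow> real" where
  "ip M f g = (\<integral>x. f x * g x \<partial>M)"

lemma L2_measurable: "f \<in> L2 M \<Longrightarrow> f \<in> borel_measurable M"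
  by (simp add: L2_def)

lemma L2_integrable_mult:
  assumes "f \<in> L2 M" "g \<in> L2 M"
  shows "integrable M (\<lambda>x. f x * g x)"
proof (rule Bochner_Integration.integrable_bound)
  show "integrable M (\<lambda>x. (f x)\<^sup>2 + (g x)\<^sup>2)"
    using assms by (simp add: L2_def)
  show "(\<lambda>x. f x * g x) \<in> borel_measurable M"
    using assms by (intro borel_measurable_times) (auto simp: L2_def)
  have "\<bar>a * b\<bar> \<le> a\<^sup>2 + b\<^sup>2" for a b :: real
    using sum_squares_bound[of "\<bar>a\<bar>" "\<bar>b\<bar>"] mult_nonneg_nonneg[of "\<bar>a\<bar>" "\<bar>b\<bar>"]
    unfolding abs_mult power2_abs by linarith
  then show "AE x in M. norm (f x * g x) \<le> norm ((f x)\<^sup>2 + (g x)\<^sup>2)"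
    by simp
qed

lemma L2_add: "f \<in> L2 M \<Longrightarrow> g \<in> L2 M \<Longrightarrow> (\<lambda>x. f x + g x) \<in> L2 M"
  using L2_integrable_mult[of f M g] by (auto simp: L2_def power2_sum mult.assoc)

lemma L2_scale: "f \<in> L2 M \<Longrightarrow> (\<lambda>x. c * f x) \<in> L2 M"
  by (auto simp: L2_def power_mult_distrib)

lemma L2_diff: "f \<in> L2 M \<Longrightarrow> g \<in> L2 M \<Longrightarrow> (\<lambda>x. f x - g x) \<in> L2 M"
  using L2_add[of f M "\<lambda>x. -1 * g x"] L2_scale[of g M "-1"] by simp

lemma L2_zero: "(\<lambda>x. 0) \<in> L2 M"
  by (simp add: L2_def)

lemma L2_sum: "(\<And>i. i \<in> I \<Longrightarrow> f i \<in> L2 M) \<Longrightarrow> (\<lambda>x. \<Sum>i\<in>I. f i x) \<in> L2 M"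
  by (induction I rule: infinite_finite_induct) (auto intro: L2_zero L2_add)

lemma ip_commute: "ip M f g = ip M g f"
  by (simp add: ip_def mult.commute)

lemma ip_self_nonneg: "0 \<le> ip M f f"
  by (simp add: ip_def)

lemma ip_self: "ip M f f = (\<integral>x. (f x)\<^sup>2 \<partial>M)"
  by (simp add: ip_def power2_eq_square)

lemma ip_add_left:
  "f \<in> L2 M \<Longrightarrow> g \<in> L2 M \<Longrightarrow> h \<in> L2 M \<Longrightarrow> ip M (\<lambda>x. f x + g x) h = ip M f h + ip M g h"
  by (simp add: ip_def distrib_right L2_integrable_mult)

lemma ip_scale_left: "ip M (\<lambda>x. c * f x) h = c * ip M f h"
  by (simp add: ip_def mult.assoc)

lemma ip_scale_right: "ip M h (\<lambda>x. c * f x) = c * ip M h f"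
  by (simp add: ip_def mult.left_commute)

lemma ip_diff_left:
  "f \<in> L2 M \<Longrightarrow> g \<in> L2 M \<Longrightarrow> h \<in> L2 M \<Longrightarrow> ip M (\<lambda>x. f x - g x) h = ip M f h - ip M g h"
  by (simp add: ip_def left_diff_distrib L2_integrable_mult)

lemma ip_add_right:
  "f \<in> L2 M \<Longrightarrow> g \<in> L2 M \<Longrightarrow> h \<in> L2 M \<Longrightarrow> ip M h (\<lambda>x. f x + g x) = ip M h f + ip M h g"
  using ip_add_left[of f M g h] by (simp add: ip_commute[of M h])

lemma ip_diff_right:
  "f \<in> L2 M \<Longrightarrow> g \<in> L2 M \<Longrightarrow> h \<in> L2 M \<Longrightarrow> ip M h (\<lambda>x. f x - g x) = ip M h f - ip M h g"
  using ip_diff_left[of f M g h] by (simp add: ip_commute[of M h])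

lemma ip_sum_left:
  assumes "\<And>i. i \<in> I \<Longrightarrow> f i \<in> L2 M" "h \<in> L2 M"
  shows "ip M (\<lambda>x. \<Sum>i\<in>I. f i x) h = (\<Sum>i\<in>I. ip M (f i) h)"
  using assms by (simp add: ip_def sum_distrib_right L2_integrable_mult Bochner_Integration.integral_sum)

lemmas ip_linear = ip_add_left ip_add_right ip_diff_left ip_diff_right ip_scale_left ip_scale_right
  L2_add L2_diff L2_scale

lemma ip_lincomb_self:
  assumes "f \<in> L2 M" "g \<in> L2 M"
  shows "ip M (\<lambda>x. a * f x + b * g x) (\<lambda>x. a * f x + b * g x)
    = a\<^sup>2 * ip M f f + 2 * a * b * ip M f g + b\<^sup>2 * ip M g g"
  using assms by (simp add: ip_linear ip_commute[of M g f] power2_eq_square algebra_simps)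

text \<open>Evaluation at the vertex \<open>- b / c\<close>. The case \<open>c = 0\<close> is kept
  because the lemma is also applied to forms in double integrals that may degenerate, where the
  conclusion forces \<open>b = 0\<close>.\<close>

lemma discriminant_le_zero:
  fixes a b c :: real
  assumes "\<And>x. 0 \<le> a + 2 * b * x + c * x\<^sup>2" "0 \<le> c"
  shows "b\<^sup>2 \<le> a * c"
proof (cases "c = 0")
  case True
  have "b = 0"
  proof (rule ccontr)
    assume "b \<noteq> 0"
    \<comment> \<open>At this point the affine function takes the value -1.\<close>
    then have "2 * b * (- (a + 1) / (2 * b)) = - (a + 1)" by simp
    then show False using assms(1)[of "- (a + 1) / (2 * b)"] True by simp
  qed
  then show ?thesis using True by simp
next
  case False
  then have c: "c > 0" using assms by simp
  have "2 * b * (- b / c) + c * (- b / c)\<^sup>2 = - (b\<^sup>2 / c)"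
    using c by (simp add: field_simps power2_eq_square)
  then have "b\<^sup>2 / c \<le> a" using assms(1)[of "- b / c"] by simp
  then show ?thesis using c by (simp add: pos_divide_le_eq)
qed

lemma ip_Cauchy_Schwarz:
  assumes f: "f \<in> L2 M" and g: "g \<in> L2 M"
  shows "(ip M f g)\<^sup>2 \<le> ip M f f * ip M g g"
proof (rule discriminant_le_zero)
  fix t :: real
  have "0 \<le> ip M (\<lambda>x. f x + t * g x) (\<lambda>x. f x + t * g x)"
    by (rule ip_self_nonneg)
  also have "\<dots> = ip M f f + 2 * ip M f g * t + ip M g g * t\<^sup>2"
    using f g by (simp add: ip_linear ip_commute[of M g f] power2_eq_square algebra_simps)
  finally show "0 \<le> ip M f f + 2 * ip M f g * t + ip M g g * t\<^sup>2" .
qed (rule ip_self_nonneg)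

lemma ip_abs_le:
  assumes f: "f \<in> L2 M" and g: "g \<in> L2 M"
  shows "\<bar>ip M f g\<bar> \<le> sqrt (ip M f f) * sqrt (ip M g g)"
  using ip_Cauchy_Schwarz[OF assms] by (metis real_sqrt_abs real_sqrt_le_iff real_sqrt_mult)

section \<open>Completeness of L2 and least-norm points of convex sets\<close>

definition L2_tendsto :: "'a measure \<Rightarrow> (nat \<Rightarrow> 'a \<Rightarrow> real) \<Rightarrow> ('a \<Rightarrow> real) \<Rightarrow> bool" where
  "L2_tendsto M f g \<longleftrightarrow> (\<lambda>n. ip M (\<lambda>x. f n x - g x) (\<lambda>x. f n x - g x)) \<longlonglongrightarrow> 0"

lemma L2_tendsto_const: "L2_tendsto M (\<lambda>n. f) f"
  by (simp add: L2_tendsto_def ip_def)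

text \<open>With \<open>u = fn - f\<close> and \<open>v = gn - g\<close> the product expands into
  \<open>f g + u v + u g + f v\<close>; Cauchy-Schwarz bounds each of the last three by a null
  sequence.\<close>

lemma L2_tendsto_ip:
  assumes fn: "\<And>n. fn n \<in> L2 M" and gn: "\<And>n. gn n \<in> L2 M" and f: "f \<in> L2 M" and g: "g \<in> L2 M"
    and lim: "L2_tendsto M fn f" "L2_tendsto M gn g"
  shows "(\<lambda>n. ip M (fn n) (gn n)) \<longlonglongrightarrow> ip M f g"
proof -
  let ?u = "\<lambda>n x. fn n x - f x" and ?v = "\<lambda>n x. gn n x - g x"
  have U: "(\<lambda>n. sqrt (ip M (?u n) (?u n))) \<longlonglongrightarrow> 0" and V: "(\<lambda>n. sqrt (ip M (?v n) (?v n))) \<longlonglongrightarrow> 0"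
    using lim tendsto_real_sqrt[of _ 0 sequentially] by (auto simp: L2_tendsto_def)
  note mem = fn gn f g L2_diff
  have 1: "(\<lambda>n. ip M (?u n) (?v n)) \<longlonglongrightarrow> 0"
    by (rule Lim_null_comparison[OF _ tendsto_mult_zero[OF U V]]) (auto intro!: always_eventually ip_abs_le mem)
  have 2: "(\<lambda>n. ip M (?u n) g) \<longlonglongrightarrow> 0"
    by (rule Lim_null_comparison[OF _ tendsto_mult_left_zero[OF U, of "sqrt (ip M g g)"]]) (auto intro!: always_eventually ip_abs_le mem)
  have 3: "(\<lambda>n. ip M f (?v n)) \<longlonglongrightarrow> 0"
    by (rule Lim_null_comparison[OF _ tendsto_mult_right_zero[OF V, of "sqrt (ip M f f)"]]) (auto intro!: always_eventually ip_abs_le mem)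
  have "(\<lambda>n. ip M f g + ip M (?u n) (?v n) + ip M (?u n) g + ip M f (?v n)) \<longlonglongrightarrow> ip M f g + 0 + 0 + 0"
    by (intro tendsto_intros 1 2 3)
  moreover have "ip M (fn n) (gn n) = ip M f g + ip M (?u n) (?v n) + ip M (?u n) g + ip M f (?v n)" for n
    by (simp add: ip_linear mem)
  ultimately show ?thesis by simp
qed

lemma (in prob_space) expectation_abs_le_ip:
  assumes "f \<in> L2 M"
  shows "expectation (\<lambda>x. \<bar>f x\<bar>) \<le> sqrt (ip M f f)"
proof -
  have "(\<lambda>x. \<bar>f x\<bar>) \<in> L2 M" "(\<lambda>x. 1) \<in> L2 M"
    using assms by (auto simp: L2_def)
  from ip_abs_le[OF this] show ?thesis
    by (simp add: ip_def prob_space)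
qed

text \<open>Riesz-Fischer by a rapidly convergent subsequence: in a probability space the L1 norm is
  at most the L2 norm, so the increments are absolutely summable almost everywhere, and Fatou
  transfers the Cauchy bound to the pointwise limit.\<close>

lemma (in prob_space) L2_complete:
  assumes f: "\<And>n. f n \<in> L2 M"
    and cauchy: "\<And>e. 0 < e \<Longrightarrow> \<exists>N. \<forall>m\<ge>N. \<forall>n\<ge>N. ip M (\<lambda>x. f m x - f n x) (\<lambda>x. f m x - f n x) < e"
  obtains g where "g \<in> L2 M" "L2_tendsto M f g"
proof -
  have [measurable]: "f n \<in> borel_measurable M" for n
    using f by (rule L2_measurable)
  \<comment> \<open>Squared distances below \<open>(1/4)^n\<close> make the L1 norms of the
    increments at most \<open>(1/2)^n\<close>.\<close>
  have "\<exists>s. \<forall>n. (\<forall>m\<ge>s n. ip M (\<lambda>x. f m x - f (s n) x) (\<lambda>x. f m x - f (s n) x) < (1/4)^n) \<and> s n < s (Suc n)"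
  proof (rule dependent_nat_choice)
    show "\<exists>k. \<forall>m\<ge>k. ip M (\<lambda>x. f m x - f k x) (\<lambda>x. f m x - f k x) < (1/4)^0"
      using cauchy[of 1] by auto
    fix k n :: nat
    obtain N where N: "\<forall>m\<ge>N. \<forall>n'\<ge>N. ip M (\<lambda>x. f m x - f n' x) (\<lambda>x. f m x - f n' x) < (1/4)^(Suc n)"
      using cauchy[of "(1/4)^(Suc n)"] by auto
    show "\<exists>y. (\<forall>m\<ge>y. ip M (\<lambda>x. f m x - f y x) (\<lambda>x. f m x - f y x) < (1/4)^(Suc n)) \<and> k < y"
      using N by (intro exI[of _ "max N (Suc k)"]) auto
  qed
  then obtain s where s: "\<And>n m. m \<ge> s n \<Longrightarrow> ip M (\<lambda>x. f m x - f (s n) x) (\<lambda>x. f m x - f (s n) x) < (1/4)^n"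
    and sm: "\<And>n. s n < s (Suc n)" by blast
  have sm': "strict_mono s" using sm by (simp add: strict_mono_Suc_iff)
  define d where "d n x = f (s (Suc n)) x - f (s n) x" for n x
  have d: "d n \<in> L2 M" for n
    unfolding d_def by (intro L2_diff f)
  have [measurable]: "d n \<in> borel_measurable M" for n
    using d by (rule L2_measurable)
  have di: "integrable M (\<lambda>x. \<bar>d n x\<bar>)" for n
    by (rule integrable_abs, rule square_integrable_imp_integrable) (use d[of n] in \<open>auto simp: L2_def\<close>)
  have d_le: "expectation (\<lambda>x. \<bar>d n x\<bar>) \<le> (1/2)^n" for n
  proof -
    have "expectation (\<lambda>x. \<bar>d n x\<bar>) \<le> sqrt (ip M (d n) (d n))"
      by (rule expectation_abs_le_ip[OF d])
    also have "\<dots> \<le> sqrt ((1/4)^n)"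
      using s[of n "s (Suc n)"] sm[of n] by (auto simp: d_def[abs_def] intro!: less_imp_le)
    also have "\<dots> = (1/2)^n"
      by (simp add: real_sqrt_power real_sqrt_divide)
    finally show ?thesis .
  qed
  have "(\<integral>\<^sup>+x. (\<Sum>n. ennreal \<bar>d n x\<bar>) \<partial>M) = (\<Sum>n. \<integral>\<^sup>+x. ennreal \<bar>d n x\<bar> \<partial>M)"
    by (rule nn_integral_suminf) measurable
  also have "\<dots> = (\<Sum>n. ennreal (expectation (\<lambda>x. \<bar>d n x\<bar>)))"
    by (simp add: nn_integral_eq_integral di)
  also have "\<dots> \<le> (\<Sum>n. ennreal ((1/2)^n))"
    by (intro suminf_le ennreal_leI d_le) auto
  also have "\<dots> = ennreal (\<Sum>n. (1/2)^n)"
    by (rule suminf_ennreal2) auto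
  also have "\<dots> < \<infinity>" by simp
  finally have "(\<integral>\<^sup>+x. (\<Sum>n. ennreal \<bar>d n x\<bar>) \<partial>M) \<noteq> \<infinity>" by simp
  then have "AE x in M. (\<Sum>n. ennreal \<bar>d n x\<bar>) \<noteq> \<infinity>"
    by (intro nn_integral_PInf_AE) measurable
  then have conv: "AE x in M. convergent (\<lambda>n. f (s n) x)"
  proof eventually_elim
    case (elim x)
    then have "summable (\<lambda>n. \<bar>d n x\<bar>)"
      by (intro summable_suminf_not_top) auto
    then have "summable (\<lambda>n. d n x)" by (rule summable_rabs_cancel)
    then have "convergent (\<lambda>n. \<Sum>i<n. d i x)" by (simp add: summable_iff_convergent)
    then have "convergent (\<lambda>n. f (s n) x - f (s 0) x)"
      by (simp add: d_def sum_lessThan_telescope[of "\<lambda>n. f (s n) x"])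
    then show ?case by (simp add: convergent_diff_const_right_iff)
  qed
  \<comment> \<open>Where the subsequence diverges \<open>lim\<close> has no meaning, but this
    happens on a null set only, and \<open>g\<close> is measurable all the same.\<close>
  define g where "g x = lim (\<lambda>n. f (s n) x)" for x
  have [measurable]: "g \<in> borel_measurable M"
    unfolding g_def by measurable
  \<comment> \<open>Fatou along the subsequence. Integrability of the difference comes out together
    with the bound, which is how \<open>g\<close> is seen to lie in L2.\<close>
  have bound: "integrable M (\<lambda>x. (f m x - g x)\<^sup>2) \<and> (\<integral>x. (f m x - g x)\<^sup>2 \<partial>M) \<le> e"
    if e: "0 \<le> e" and ev: "\<forall>n\<ge>N. ip M (\<lambda>x. f m x - f n x) (\<lambda>x. f m x - f n x) \<le> e" for m N e
  proof -
    have "(\<integral>\<^sup>+x. ennreal ((f m x - g x)\<^sup>2) \<partial>M) = (\<integral>\<^sup>+x. liminf (\<lambda>n. ennreal ((f m x - f (s n) x)\<^sup>2)) \<partial>M)"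
    proof (rule nn_integral_cong_AE, use conv in eventually_elim)
      case (elim x)
      then have "(\<lambda>n. f (s n) x) \<longlonglongrightarrow> g x"
        by (simp add: g_def convergent_LIMSEQ_iff)
      then have "(\<lambda>n. ennreal ((f m x - f (s n) x)\<^sup>2)) \<longlonglongrightarrow> ennreal ((f m x - g x)\<^sup>2)"
        by (intro tendsto_intros) auto
      then show ?case using lim_imp_Liminf[OF sequentially_bot] by metis
    qed
    also have "\<dots> \<le> liminf (\<lambda>n. \<integral>\<^sup>+x. ennreal ((f m x - f (s n) x)\<^sup>2) \<partial>M)"
      by (rule nn_integral_liminf) measurable
    also have "\<dots> = liminf (\<lambda>n. ennreal (ip M (\<lambda>x. f m x - f (s n) x) (\<lambda>x. f m x - f (s n) x)))"
      using L2_diff[OF f f] by (simp add: nn_integral_eq_integral L2_def ip_self)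
    also have "\<dots> \<le> liminf (\<lambda>n. ennreal e)"
    proof (rule Liminf_mono, rule eventually_sequentiallyI[of N])
      fix n assume "N \<le> n"
      then have "N \<le> s n" using seq_suble[OF sm', of n] by simp
      then show "ennreal (ip M (\<lambda>x. f m x - f (s n) x) (\<lambda>x. f m x - f (s n) x)) \<le> ennreal e"
        using ev by (intro ennreal_leI) auto
    qed
    also have "\<dots> = ennreal e" by (simp add: Liminf_const)
    finally have le: "(\<integral>\<^sup>+x. ennreal ((f m x - g x)\<^sup>2) \<partial>M) \<le> ennreal e" .
    then have int: "integrable M (\<lambda>x. (f m x - g x)\<^sup>2)"
      by (intro integrableI_bounded) (auto simp: order_le_less_trans)
    with le e show ?thesis by (simp add: nn_integral_eq_integral)
  qed
  obtain N where N: "\<forall>m\<ge>N. \<forall>n\<ge>N. ip M (\<lambda>x. f m x - f n x) (\<lambda>x. f m x - f n x) < 1"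
    using cauchy[of 1] by auto
  then have "(\<lambda>x. f N x - g x) \<in> L2 M"
    using bound[of 1 N N] by (auto simp: L2_def less_imp_le)
  from L2_diff[OF f[of N] this] have g: "g \<in> L2 M" by simp
  have "L2_tendsto M f g"
    unfolding L2_tendsto_def
  proof (rule LIMSEQ_I)
    fix e :: real assume "0 < e"
    then obtain N where N: "\<forall>m\<ge>N. \<forall>n\<ge>N. ip M (\<lambda>x. f m x - f n x) (\<lambda>x. f m x - f n x) < e/2"
      using cauchy[of "e/2"] by auto
    have "ip M (\<lambda>x. f m x - g x) (\<lambda>x. f m x - g x) < e" if "N \<le> m" for m
      using bound[of "e/2" N m] N that \<open>0 < e\<close> by (auto simp: ip_self less_imp_le)
    then show "\<exists>no. \<forall>n\<ge>no. norm (ip M (\<lambda>x. f n x - g x) (\<lambda>x. f n x - g x) - 0) < e"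
      by (auto simp: ip_self_nonneg)
  qed
  with g show ?thesis by (rule that)
qed

text \<open>The least-norm element of the closure of \<open>S\<close>, given with a sequence from
  \<open>S\<close> because it may lie outside \<open>S\<close>. The last property is the variational
  inequality at the minimum.\<close>

lemma (in prob_space) L2_nearest_point:
  assumes S: "S \<subseteq> L2 M" "S \<noteq> {}"
    and conv: "\<And>u v l. u \<in> S \<Longrightarrow> v \<in> S \<Longrightarrow> 0 \<le> l \<Longrightarrow> l \<le> 1 \<Longrightarrow> (\<lambda>x. (1 - l) * u x + l * v x) \<in> S"
  obtains V v where "V \<in> L2 M" "\<And>n::nat. v n \<in> S" "L2_tendsto M v V" "\<And>u. u \<in> S \<Longrightarrow> ip M V V \<le> ip M u V"
proof -
  define m where "m = (INF u\<in>S. ip M u u)"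
  have bdd: "bdd_below ((\<lambda>u. ip M u u) ` S)"
    by (auto intro!: bdd_belowI[of _ 0] ip_self_nonneg)
  have m_le: "m \<le> ip M u u" if "u \<in> S" for u
    unfolding m_def using bdd that by (rule cINF_lower)
  have "\<exists>u\<in>S. ip M u u < m + 1 / real (Suc n)" for n
    using cINF_less_iff[OF S(2) bdd, of "m + 1 / real (Suc n)"] by (simp add: m_def[symmetric])
  then obtain v where v: "\<And>n. v n \<in> S" and vm: "\<And>n. ip M (v n) (v n) < m + 1 / real (Suc n)"
    by metis
  have vL: "v n \<in> L2 M" for n using v S by auto
  \<comment> \<open>Parallelogram law: the midpoint lies in \<open>S\<close>, so its squared norm is
    at least \<open>m\<close>, and near-minimal norms force closeness.\<close>
  have par: "ip M (\<lambda>x. v i x - v j x) (\<lambda>x. v i x - v j x) \<le> 2 / real (Suc i) + 2 / real (Suc j)" for i j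
  proof -
    have "m \<le> ip M (\<lambda>x. (1 - 1/2) * v i x + 1/2 * v j x) (\<lambda>x. (1 - 1/2) * v i x + 1/2 * v j x)"
      by (intro m_le conv v) auto
    also have "\<dots> = 1/4 * (ip M (v i) (v i) + 2 * ip M (v i) (v j) + ip M (v j) (v j))"
      unfolding ip_lincomb_self[OF vL vL] by (simp add: power2_eq_square)
    finally have "- (2 * ip M (v i) (v j)) \<le> ip M (v i) (v i) + ip M (v j) (v j) - 4 * m"
      by simp
    moreover have "ip M (\<lambda>x. v i x - v j x) (\<lambda>x. v i x - v j x)
        = ip M (v i) (v i) - 2 * ip M (v i) (v j) + ip M (v j) (v j)"
      by (simp add: ip_linear vL ip_commute[of M "v j" "v i"])
    ultimately show ?thesis using vm[of i] vm[of j] by simp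
  qed
  have "\<exists>V. V \<in> L2 M \<and> L2_tendsto M v V"
  proof (rule L2_complete[of v])
    fix e :: real assume e: "0 < e"
    obtain N where N: "4 / e < real N" using reals_Archimedean2 by blast
    then have N': "0 < real N" using e by (smt (verit) divide_pos_pos)
    show "\<exists>N. \<forall>m\<ge>N. \<forall>n\<ge>N. ip M (\<lambda>x. v m x - v n x) (\<lambda>x. v m x - v n x) < e"
    proof (intro exI[of _ N] allI impI)
      fix i j assume ij: "N \<le> i" "N \<le> j"
      have "2 / real (Suc i) < 2 / real N" "2 / real (Suc j) < 2 / real N"
        using ij N' by (auto intro!: divide_strict_left_mono)
      moreover have "4 / real N < e" using N e N' by (simp add: field_simps)
      ultimately show "ip M (\<lambda>x. v i x - v j x) (\<lambda>x. v i x - v j x) < e"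
        using par[of i j] by linarith
    qed
  qed (use vL in auto)
  then obtain V where V: "V \<in> L2 M" and lim: "L2_tendsto M v V" by blast
  have "(\<lambda>n. ip M (v n) (v n)) \<longlonglongrightarrow> ip M V V"
    by (rule L2_tendsto_ip[OF vL vL V V lim lim])
  then have "ip M V V \<le> m + 0"
    by (rule LIMSEQ_le[OF _ tendsto_add[OF tendsto_const LIMSEQ_inverse_real_of_nat]])
      (use vm in \<open>auto simp: inverse_eq_divide intro!: exI[of _ 0] less_imp_le\<close>)
  then have Vm: "ip M V V \<le> m" by simp
  have "ip M V V \<le> ip M u V" if u: "u \<in> S" for u
  proof (rule ccontr)
    assume neg: "\<not> ip M V V \<le> ip M u V"
    define \<delta> where "\<delta> = ip M V V - ip M u V"
    have uL: "u \<in> L2 M" using u S by auto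
    define Q where "Q = ip M (\<lambda>x. u x - V x) (\<lambda>x. u x - V x)"
    have Q: "Q = ip M u u - 2 * ip M u V + ip M V V"
      by (simp add: Q_def ip_linear uL V ip_commute[of M V u])
    have \<delta>: "\<delta> > 0" using neg by (simp add: \<delta>_def)
    \<comment> \<open>First-order variation along the segment from \<open>V\<close> to
      \<open>u\<close>. As \<open>V\<close> may lie outside \<open>S\<close>, the inequality is
      proved for the segments from \<open>v n\<close> and passed to the limit.\<close>
    have ineq: "0 \<le> - 2 * l * \<delta> + l\<^sup>2 * Q" if l: "0 \<le> l" "l \<le> 1" for l
    proof -
      have "(\<lambda>n. (1 - l)\<^sup>2 * ip M (v n) (v n) + 2 * l * (1 - l) * ip M (v n) u + l\<^sup>2 * ip M u u)
        \<longlonglongrightarrow> (1 - l)\<^sup>2 * ip M V V + 2 * l * (1 - l) * ip M V u + l\<^sup>2 * ip M u u"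
        by (intro tendsto_intros L2_tendsto_ip vL V uL lim L2_tendsto_const)
      moreover have "m \<le> (1 - l)\<^sup>2 * ip M (v n) (v n) + 2 * l * (1 - l) * ip M (v n) u + l\<^sup>2 * ip M u u" for n
      proof -
        have "m \<le> ip M (\<lambda>x. (1 - l) * v n x + l * u x) (\<lambda>x. (1 - l) * v n x + l * u x)"
          by (intro m_le conv v u l)
        also have "\<dots> = (1 - l)\<^sup>2 * ip M (v n) (v n) + 2 * l * (1 - l) * ip M (v n) u + l\<^sup>2 * ip M u u"
          unfolding ip_lincomb_self[OF vL uL] by (simp add: mult.assoc mult.left_commute)
        finally show ?thesis .
      qed
      ultimately have "m \<le> (1 - l)\<^sup>2 * ip M V V + 2 * l * (1 - l) * ip M V u + l\<^sup>2 * ip M u u"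
        by (intro LIMSEQ_le_const) auto
      with Vm have "0 \<le> (1 - l)\<^sup>2 * ip M V V + 2 * l * (1 - l) * ip M V u + l\<^sup>2 * ip M u u - ip M V V"
        by simp
      also have "\<dots> = - 2 * l * \<delta> + l\<^sup>2 * Q"
        by (simp add: Q \<delta>_def ip_commute[of M V u] power2_eq_square algebra_simps)
      finally show ?thesis .
    qed
    \<comment> \<open>Small enough that \<open>l * Q \<le> \<delta>\<close>, so the quadratic term
      cannot compensate \<open>- 2 * l * \<delta>\<close>; the summand 1 keeps the denominator
      positive.\<close>
    define l where "l = min 1 (\<delta> / (Q + 1))"
    have Q0: "0 \<le> Q" by (simp add: Q_def ip_self_nonneg)
    have l: "0 < l" "l \<le> 1" using \<delta> Q0 by (auto simp: l_def)
    have "l * Q \<le> \<delta> / (Q + 1) * Q" using Q0 by (intro mult_right_mono) (auto simp: l_def)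
    also have "\<dots> \<le> \<delta>" using Q0 \<delta> by (simp add: field_simps)
    finally have "l * (l * Q) \<le> l * \<delta>" using l by simp
    moreover have "0 < l * \<delta>" using l \<delta> by simp
    ultimately show False using ineq[of l] l \<delta> by (simp add: power2_eq_square)
  qed
  then show ?thesis using that[OF V v lim] by blast
qed

section \<open>Probability measures on compact sets\<close>

text \<open>
  Helly's selection theorem is only available on the real line.  The points of \<open>K\<close> are therefore
  coded by their memberships in a countable basis, read as ternary digits 0 and 1: reals that are close
  then share a long prefix, so that decoding is uniformly continuous and extends to the closure of the
  set of codes.
\<close>

lemma borel_coding:
  fixes K :: "'a::polish_space set"
  assumes K: "compact K"
  obtains S :: "'a \<Rightarrow> real" and f :: "real \<Rightarrow> 'a"
  where "S \<in> borel_measurable borel" "range S \<subseteq> {0..2}"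
    "continuous_on (closure (S ` K)) f" "f ` closure (S ` K) \<subseteq> K" "\<And>x. x \<in> K \<Longrightarrow> f (S x) = x"
proof -
  obtain B :: "'a set set" where B: "countable B" "topological_basis B"
    using ex_countable_basis by auto
  have "B \<noteq> {}"
    using topological_basisE[OF B(2) open_UNIV UNIV_I] by blast
  define b where "b = from_nat_into B"
  have rb: "range b = B"
    unfolding b_def using \<open>B \<noteq> {}\<close> B(1) by (rule range_from_nat_into)
  have ob: "open (b n)" for n
    using topological_basis_open[OF B(2)] rb by blast
  define S :: "'a \<Rightarrow> real" where "S x = (\<Sum>n. (1/3)^n * indicator (b n) x)" for x
  have geo: "summable (\<lambda>n. (1/3::real)^n)" "(\<Sum>n. (1/3::real)^n) = 3/2"
    by (simp_all add: suminf_geometric)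
  have smS: "summable (\<lambda>n. (1/3)^n * indicator (b n) x :: real)" for x
    by (rule summable_comparison_test'[OF geo(1), of 0]) (auto simp: indicator_def)
  have S_meas: "S \<in> borel_measurable borel"
    unfolding S_def using ob by (intro borel_measurable_suminf) measurable
  have S_range: "range S \<subseteq> {0..2}"
  proof clarify
    fix x
    have "S x \<le> (\<Sum>n. (1/3::real)^n)"
      unfolding S_def by (intro suminf_le smS geo) (auto simp: indicator_def)
    moreover have "0 \<le> S x"
      unfolding S_def by (intro suminf_nonneg smS) auto
    ultimately show "S x \<in> {0..2}" using geo by simp
  qed
  \<comment> \<open>At the first digit \<open>j\<close> where the codes differ, that digit
    contributes \<open>(1/3)^j\<close> and the later ones at most \<open>(1/3)^j / 2\<close> in
    total. In base 2 the tail could cancel the leading digit.\<close>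
  have agree: "x \<in> b i \<longleftrightarrow> y \<in> b i" if "\<bar>S x - S y\<bar> < (1/3)^n / 2" "i \<le> n" for x y n i
  proof (rule ccontr)
    assume "\<not> (x \<in> b i \<longleftrightarrow> y \<in> b i)"
    then obtain j where j: "\<not> (x \<in> b j \<longleftrightarrow> y \<in> b j)" "j \<le> i"
      and below: "\<And>k. k < j \<Longrightarrow> x \<in> b k \<longleftrightarrow> y \<in> b k"
      using exists_least_iff[of "\<lambda>i. \<not> (x \<in> b i \<longleftrightarrow> y \<in> b i)"] by (metis not_less)
    define d :: "nat \<Rightarrow> real" where "d k = (1/3)^k * indicator (b k) x - (1/3)^k * indicator (b k) y" for k
    have sd: "summable d" unfolding d_def by (intro summable_diff smS)
    have dle: "\<bar>d k\<bar> \<le> (1/3)^k" for k by (auto simp: d_def indicator_def)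
    have tail: "(\<lambda>k. (1/3::real)^(k + Suc j)) sums ((1/3)^j / 2)"
      using sums_mult[OF geometric_sums[of "1/3::real"], of "(1/3)^Suc j"] by (simp add: power_add mult_ac)
    have "S x - S y = (\<Sum>k. d k)"
      unfolding S_def d_def by (intro suminf_diff smS)
    also have "\<dots> = (\<Sum>k. d (k + Suc j)) + (\<Sum>k<Suc j. d k)"
      by (rule suminf_split_initial_segment[OF sd])
    also have "(\<Sum>k<Suc j. d k) = d j"
      using below by (simp add: d_def indicator_def)
    finally have eq: "S x - S y = (\<Sum>k. d (k + Suc j)) + d j" .
    have sda: "summable (\<lambda>k. \<bar>d (k + Suc j)\<bar>)"
      by (rule summable_comparison_test'[OF sums_summable[OF tail], of 0]) (auto simp: dle simp del: power_Suc add_Suc_right)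
    have "\<bar>\<Sum>k. d (k + Suc j)\<bar> \<le> (\<Sum>k. \<bar>d (k + Suc j)\<bar>)"
      by (rule summable_rabs[OF sda])
    also have "\<dots> \<le> (\<Sum>k. (1/3::real)^(k + Suc j))"
      by (intro suminf_le sda sums_summable[OF tail] dle)
    also have "\<dots> = (1/3)^j / 2" using tail by (rule sums_unique[symmetric])
    finally have "\<bar>\<Sum>k. d (k + Suc j)\<bar> \<le> (1/3)^j / 2" .
    moreover have "\<bar>d j\<bar> = (1/3)^j" using j(1) by (auto simp: d_def indicator_def)
    ultimately have "(1/3)^j / 2 \<le> \<bar>S x - S y\<bar>" using eq by linarith
    moreover have "(1/3::real)^n \<le> (1/3)^j"
      using j(2) that(2) by (intro power_decreasing) auto
    ultimately show False using that(1) by linarith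
  qed
  \<comment> \<open>Finitely many basis sets inside balls of radius \<open>e/2\<close> cover
    \<open>K\<close>; agreement up to their largest index puts \<open>y\<close> into the same small
    set as \<open>x\<close>. Injectivity of \<open>S\<close> on \<open>K\<close> follows with
    \<open>e = dist x y\<close>.\<close>
  have unif: "\<exists>\<delta>>0. \<forall>x\<in>K. \<forall>y\<in>K. \<bar>S x - S y\<bar> < \<delta> \<longrightarrow> dist x y < e" if e: "0 < e" for e
  proof -
    define I where "I = {n. \<exists>z. b n \<subseteq> ball z (e/2)}"
    have "K \<subseteq> (\<Union>n\<in>I. b n)"
    proof
      fix x assume "x \<in> K"
      obtain U where "U \<in> B" "x \<in> U" "U \<subseteq> ball x (e/2)"
        using topological_basisE[OF B(2) open_ball[of x "e/2"], of x] e by auto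
      then show "x \<in> (\<Union>n\<in>I. b n)" using rb by (auto simp: I_def)
    qed
    then obtain J where J: "J \<subseteq> I" "finite J" "K \<subseteq> (\<Union>n\<in>J. b n)"
      using compactE_image[OF K, of I b] ob by metis
    obtain n where n: "\<And>i. i \<in> J \<Longrightarrow> i \<le> n"
      using finite_nat_set_iff_bounded_le J(2) by auto
    have "dist x y < e" if xy: "x \<in> K" "y \<in> K" "\<bar>S x - S y\<bar> < (1/3)^n / 2" for x y
    proof -
      obtain i where i: "i \<in> J" "x \<in> b i" using J(3) xy(1) by auto
      then have "y \<in> b i" using agree[OF xy(3) n[OF i(1)]] by simp
      moreover obtain z where "b i \<subseteq> ball z (e/2)" using i(1) J(1) by (auto simp: I_def)
      ultimately have "dist z x < e/2" "dist z y < e/2" using i(2) by auto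
      then show ?thesis using dist_triangle3[of x y z] by simp
    qed
    then show ?thesis by (intro exI[of _ "(1/3)^n / 2"]) auto
  qed
  have inj: "inj_on S K"
  proof (rule inj_onI, rule ccontr)
    fix x y assume xy: "x \<in> K" "y \<in> K" "S x = S y" "x \<noteq> y"
    show False using unif[of "dist x y"] xy by force
  qed
  have "uniformly_continuous_on (S ` K) (inv_into K S)"
    unfolding uniformly_continuous_on_def
  proof (intro allI impI)
    fix e :: real assume "0 < e"
    then obtain \<delta> where "\<delta> > 0" "\<forall>x\<in>K. \<forall>y\<in>K. \<bar>S x - S y\<bar> < \<delta> \<longrightarrow> dist x y < e"
      using unif by blast
    then show "\<exists>d>0. \<forall>x\<in>S ` K. \<forall>x'\<in>S ` K. dist x' x < d \<longrightarrow> dist (inv_into K S x') (inv_into K S x) < e"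
      using inj by (intro exI[of _ \<delta>]) (auto simp: dist_real_def)
  qed
  then obtain f where f: "uniformly_continuous_on (closure (S ` K)) f" "\<And>x. x \<in> S ` K \<Longrightarrow> inv_into K S x = f x"
    using uniformly_continuous_on_extension_on_closure by metis
  have cf: "continuous_on (closure (S ` K)) f"
    using f(1) by (rule uniformly_continuous_imp_continuous)
  have fS: "f (S x) = x" if "x \<in> K" for x
    using f(2)[of "S x"] that inj by simp
  have "f ` closure (S ` K) \<subseteq> K"
    using cf compact_imp_closed[OF K] fS by (intro image_closure_subset) auto
  with S_meas S_range cf fS show ?thesis using that by blast
qed

lemma borel_probsD:
  assumes "\<mu> \<in> borel_probs K"
  shows "prob_space \<mu>" "sets \<mu> = sets (restrict_space borel K)" "space \<mu> = K"
  using assms sets_eq_imp_space_eq[of \<mu> "restrict_space borel K"]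
  by (auto simp: borel_probs_def space_restrict_space)

lemma borel_probs_measurable:
  assumes "\<mu> \<in> borel_probs K" "continuous_on K h"
  shows "h \<in> borel_measurable \<mu>"
  using borel_measurable_continuous_on_restrict[OF assms(2)] borel_probsD(2)[OF assms(1)]
  by (simp cong: measurable_cong_sets)

lemma borel_probs_integrable:
  fixes h :: "'a::topological_space \<Rightarrow> real"
  assumes "\<mu> \<in> borel_probs K" "compact K" "continuous_on K h"
  shows "integrable \<mu> h"
proof -
  interpret prob_space \<mu> using borel_probsD[OF assms(1)] by simp
  have "bounded (h ` K)"
    using assms by (intro compact_imp_bounded compact_continuous_image)
  then obtain B where "\<And>x. x \<in> K \<Longrightarrow> norm (h x) \<le> B"
    by (auto simp: bounded_iff)
  then show ?thesis
    using borel_probsD(3)[OF assms(1)] borel_probs_measurable[OF assms(1,3)]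
    by (intro integrable_const_bound[of _ B]) auto
qed

lemma distr_in_borel_probs:
  assumes "prob_space N" "g \<in> N \<rightarrow>\<^sub>M restrict_space borel K"
  shows "distr N (restrict_space borel K) g \<in> borel_probs K"
  using prob_space.prob_space_distr[OF assms] by (simp add: borel_probs_def)

lemma integral_distr_borel_probs:
  fixes h :: "'a::topological_space \<Rightarrow> real"
  assumes "g \<in> N \<rightarrow>\<^sub>M restrict_space borel K" "continuous_on K h"
  shows "(\<integral>x. h x \<partial>distr N (restrict_space borel K) g) = (\<integral>x. h (g x) \<partial>N)"
  using assms by (intro integral_distr borel_measurable_continuous_on_restrict)

section \<open>Weak convergence and sequential compactness of probability measures on a compact
  set\<close>

definition weak_tendsto :: "'a::topological_space set \<Rightarrow> (nat \<Rightarrow> 'a measure) \<Rightarrow> 'a measure \<Rightarrow> bool" where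
  "weak_tendsto K \<mu> \<nu> \<longleftrightarrow>
     (\<forall>h::'a \<Rightarrow> real. continuous_on K h \<longrightarrow> (\<lambda>n. \<integral>x. h x \<partial>\<mu> n) \<longlonglongrightarrow> (\<integral>x. h x \<partial>\<nu>))"

lemma weak_tendsto_subseq:
  assumes "weak_tendsto K \<mu> \<nu>" "strict_mono s"
  shows "weak_tendsto K (\<lambda>n. \<mu> (s n)) \<nu>"
  using assms LIMSEQ_subseq_LIMSEQ[unfolded comp_def] unfolding weak_tendsto_def by blast

text \<open>The codes lie in a bounded interval, so their laws are tight on the line and have a
  weakly convergent subsequence. Skorohod's representation turns this into pointwise convergence of
  real variables, which survives decoding because \<open>f\<close> is continuous on the closure of
  the codes; the limit measure is the law of the decoded limit. Continuity is asked of the decoding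
  alone, as \<open>S\<close> is merely measurable.\<close>

lemma borel_probs_seq_compact:
  fixes K :: "'a::polish_space set"
  assumes K: "compact K" and \<mu>: "\<And>n. \<mu> n \<in> borel_probs K"
  obtains \<nu> s where "\<nu> \<in> borel_probs K" "strict_mono (s :: nat \<Rightarrow> nat)" "weak_tendsto K (\<lambda>n. \<mu> (s n)) \<nu>"
proof -
  have ne: "K \<noteq> {}"
    using borel_probsD[OF \<mu>[of 0]] prob_space.not_empty by auto
  then obtain k0 where k0: "k0 \<in> K" by auto
  obtain S f where [measurable]: "S \<in> borel_measurable borel" and S: "range S \<subseteq> {0..2::real}"
    and f: "continuous_on (closure (S ` K)) f" "f ` closure (S ` K) \<subseteq> K" and fS: "\<And>x. x \<in> K \<Longrightarrow> f (S x) = x"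
    using borel_coding[OF K] by metis
  define C where "C = closure (S ` K)"
  have C[measurable]: "C \<in> sets borel" by (simp add: C_def)
  \<comment> \<open>A total Borel version of the decoding; the value \<open>k0\<close> off
    \<open>C\<close> keeps it in \<open>K\<close>.\<close>
  define g where "g = (\<lambda>x. if x \<in> C then f x else k0)"
  have gK: "g x \<in> K" for x using f(2) k0 by (auto simp: g_def C_def)
  have g_meas: "g \<in> borel_measurable borel"
    unfolding g_def using f(1) C
    by (subst measurable_If_restrict_space_iff)
      (auto simp: C_def intro!: borel_measurable_continuous_on_restrict)
  have Sm: "S \<in> borel_measurable (\<mu> n)" for n
    using borel_probsD(2)[OF \<mu>[of n]] measurable_restrict_space1[of S borel borel K]
    by (simp cong: measurable_cong_sets)
  have rd: "real_distribution (distr (\<mu> n) borel S)" for n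
    using borel_probsD(1)[OF \<mu>[of n]] Sm[of n] by (intro prob_space.real_distribution_distr)
  have "tight (\<lambda>n. distr (\<mu> n) borel S)"
    unfolding tight_def
  proof (intro conjI allI impI rd)
    fix e :: real assume e: "0 < e"
    show "\<exists>a b. a < b \<and> (\<forall>n. 1 - e < measure (distr (\<mu> n) borel S) {a<..b})"
    \<comment> \<open>The interval is open on the left, so its endpoint must lie strictly below the
      range \<open>{0..2}\<close> of the codes.\<close>
    proof (rule exI[of _ "-1"], rule exI[of _ 2], intro conjI allI)
      fix n
      have "S -` {-1<..2} \<inter> space (\<mu> n) = space (\<mu> n)"
      proof -
        have "S x \<in> {0..2}" for x using S rangeI[of S x] by blast
        then show ?thesis by force
      qed
      then have "measure (distr (\<mu> n) borel S) {-1<..2} = measure (\<mu> n) (space (\<mu> n))"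
        using Sm[of n] by (subst measure_distr) auto
      then show "1 - e < measure (distr (\<mu> n) borel S) {-1<..2}"
        using e prob_space.prob_space[OF borel_probsD(1)[OF \<mu>[of n]]] by simp
    qed simp
  qed
  from tight_imp_convergent_subsubsequence[OF this, of id] obtain s N where
    s: "strict_mono (s :: nat \<Rightarrow> nat)" and N: "real_distribution N"
    and conv: "weak_conv_m (\<lambda>n. distr (\<mu> (s n)) borel S) N"
    by (auto simp: strict_mono_id comp_def)
  from Skorohod[OF _ N conv] rd obtain \<Omega> :: "real measure" and Y Z where
    \<Omega>: "prob_space \<Omega>" and Y[measurable]: "\<And>n. Y n \<in> borel_measurable \<Omega>" and Z: "Z \<in> \<Omega> \<rightarrow>\<^sub>M lborel"
    and dY: "\<And>n. distr \<Omega> borel (Y n) = distr (\<mu> (s n)) borel S"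
    and YZ: "\<And>x. x \<in> space \<Omega> \<Longrightarrow> (\<lambda>n. Y n x) \<longlonglongrightarrow> Z x"
    by metis
  have [measurable]: "Z \<in> borel_measurable \<Omega>" using Z by simp
  interpret \<Omega>: prob_space \<Omega> by (rule \<Omega>)
  \<comment> \<open>\<open>Y n\<close> has the law of \<open>S\<close> under a measure on
    \<open>K\<close>, hence lies in \<open>C\<close> almost surely; closedness of \<open>C\<close>
    later carries this over to the limit \<open>Z\<close>.\<close>
  have "AE x in \<Omega>. Y n x \<in> C" for n
  proof -
    have "AE y in distr (\<mu> (s n)) borel S. y \<in> C"
      using Sm[of "s n"] borel_probsD(3)[OF \<mu>[of "s n"]] closure_subset[of "S ` K"]
      by (subst AE_distr_iff) (auto simp: C_def)
    then have "AE y in distr \<Omega> borel (Y n). y \<in> C" by (subst dY)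
    then show ?thesis by (subst (asm) AE_distr_iff) auto
  qed
  then have AEC: "AE x in \<Omega>. \<forall>n. Y n x \<in> C" by (simp add: AE_all_countable)
  have gm: "g \<in> borel \<rightarrow>\<^sub>M restrict_space borel K"
    using g_meas gK by (intro measurable_restrict_space2) auto
  define \<nu> where "\<nu> = distr \<Omega> (restrict_space borel K) (\<lambda>x. g (Z x))"
  have gZ: "(\<lambda>x. g (Z x)) \<in> \<Omega> \<rightarrow>\<^sub>M restrict_space borel K"
    using gm by measurable
  have \<nu>: "\<nu> \<in> borel_probs K"
    unfolding \<nu>_def using \<Omega> gZ by (rule distr_in_borel_probs)
  have "weak_tendsto K (\<lambda>n. \<mu> (s n)) \<nu>"
    unfolding weak_tendsto_def
  proof (intro allI impI)
    fix h :: "'a \<Rightarrow> real" assume h: "continuous_on K h"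
    have hg[measurable]: "(\<lambda>x. h (g x)) \<in> borel_measurable borel"
      using gm borel_measurable_continuous_on_restrict[OF h] by (rule measurable_compose)
    have "bounded (h ` K)"
      using K h by (intro compact_imp_bounded compact_continuous_image)
    then obtain b where b: "\<And>x. x \<in> K \<Longrightarrow> \<bar>h x\<bar> \<le> b"
      by (auto simp: bounded_iff)
    have "(\<integral>x. h x \<partial>\<mu> (s n)) = (\<integral>x. h (g (Y n x)) \<partial>\<Omega>)" for n
    proof -
      have "(\<integral>x. h x \<partial>\<mu> (s n)) = (\<integral>x. h (g (S x)) \<partial>\<mu> (s n))"
        using borel_probsD(3)[OF \<mu>[of "s n"]] closure_subset[of "S ` K"] fS
        by (intro Bochner_Integration.integral_cong) (auto simp: g_def C_def)
      also have "\<dots> = (\<integral>y. h (g y) \<partial>distr (\<mu> (s n)) borel S)"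
        using Sm by (intro integral_distr[symmetric]) auto
      also have "\<dots> = (\<integral>y. h (g y) \<partial>distr \<Omega> borel (Y n))" by (subst dY) (rule refl)
      also have "\<dots> = (\<integral>x. h (g (Y n x)) \<partial>\<Omega>)"
        by (intro integral_distr) auto
      finally show ?thesis .
    qed
    moreover have "(\<integral>x. h x \<partial>\<nu>) = (\<integral>x. h (g (Z x)) \<partial>\<Omega>)"
      unfolding \<nu>_def by (rule integral_distr_borel_probs[OF gZ h])
    moreover have "(\<lambda>n. \<integral>x. h (g (Y n x)) \<partial>\<Omega>) \<longlonglongrightarrow> (\<integral>x. h (g (Z x)) \<partial>\<Omega>)"
    proof (rule integral_dominated_convergence[where w = "\<lambda>_. b"])
      show "AE x in \<Omega>. (\<lambda>n. h (g (Y n x))) \<longlonglongrightarrow> h (g (Z x))"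
        using AEC AE_space
      proof eventually_elim
        case (elim x)
        have "closed C" by (simp add: C_def)
        then have ZC: "Z x \<in> C"
          using elim YZ[of x] by (metis closed_sequentially)
        have "continuous_on C (\<lambda>y. h (f y))"
          using f h unfolding C_def by (intro continuous_on_compose2[OF h])
        then have "(\<lambda>n. h (f (Y n x))) \<longlonglongrightarrow> h (f (Z x))"
          using ZC elim YZ[of x] by (simp add: continuous_on_sequentially comp_def)
        then show ?case using elim ZC by (simp add: g_def)
      qed
    qed (auto simp: b gK)
    ultimately show "(\<lambda>n. \<integral>x. h x \<partial>\<mu> (s n)) \<longlonglongrightarrow> (\<integral>x. h x \<partial>\<nu>)" by simp
  qed
  with \<nu> s show ?thesis by (rule that)
qed

section \<open>Double integrals of continuous kernels under weak limits\<close>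

lemma borel_probs_abs_integral_diff_le:
  fixes f g :: "'a::topological_space \<Rightarrow> real"
  assumes \<mu>: "\<mu> \<in> borel_probs K" "compact K" and f: "continuous_on K f" and g: "continuous_on K g"
    and le: "\<And>x. x \<in> K \<Longrightarrow> \<bar>f x - g x\<bar> \<le> e"
  shows "\<bar>(\<integral>x. f x \<partial>\<mu>) - (\<integral>x. g x \<partial>\<mu>)\<bar> \<le> e"
proof -
  interpret prob_space \<mu> using borel_probsD[OF \<mu>(1)] by simp
  have int: "integrable \<mu> f" "integrable \<mu> g" "integrable \<mu> (\<lambda>x. f x - g x)"
    using \<mu> f g by (auto intro!: borel_probs_integrable continuous_on_diff)
  have "(\<integral>x. f x \<partial>\<mu>) - (\<integral>x. g x \<partial>\<mu>) = (\<integral>x. f x - g x \<partial>\<mu>)"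
    using int by simp
  moreover have "\<bar>\<integral>x. f x - g x \<partial>\<mu>\<bar> \<le> (\<integral>x. \<bar>f x - g x\<bar> \<partial>\<mu>)"
    by (rule integral_abs_bound)
  moreover have "(\<integral>x. \<bar>f x - g x\<bar> \<partial>\<mu>) \<le> (\<integral>x. e \<partial>\<mu>)"
    using int le borel_probsD(3)[OF \<mu>(1)] by (intro integral_mono) auto
  moreover have "(\<integral>x. e \<partial>\<mu>) = e" by (simp add: prob_space)
  ultimately show ?thesis by linarith
qed

lemma continuous_on_section:
  assumes "continuous_on (K1 \<times> K2) (\<lambda>(s, t). Q s t)" "s \<in> K1"
  shows "continuous_on K2 (\<lambda>t. Q s t)"
proof -
  have "continuous_on K2 (\<lambda>t. (s, t))" by (intro continuous_intros)
  from continuous_on_compose2[OF assms(1) this] show ?thesis using assms(2) by auto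
qed

text \<open>Since \<open>d\<close> does not depend on \<open>t\<close>, the same modulus holds after
  integrating over \<open>t\<close> against any probability measure on \<open>K2\<close>.\<close>

lemma equicontinuous_sections:
  fixes Q :: "'a::metric_space \<Rightarrow> 'b::metric_space \<Rightarrow> real"
  assumes "compact K1" "compact K2" "continuous_on (K1 \<times> K2) (\<lambda>(s, t). Q s t)" "0 < e"
  obtains d where "0 < d"
    "\<And>s s' t. s \<in> K1 \<Longrightarrow> s' \<in> K1 \<Longrightarrow> t \<in> K2 \<Longrightarrow> dist s s' < d \<Longrightarrow> \<bar>Q s t - Q s' t\<bar> \<le> e"
proof -
  have "uniformly_continuous_on (K1 \<times> K2) (\<lambda>(s, t). Q s t)"
    using assms by (intro compact_uniformly_continuous compact_Times)
  then obtain d where d: "0 < d"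
    "\<And>z z'. z \<in> K1 \<times> K2 \<Longrightarrow> z' \<in> K1 \<times> K2 \<Longrightarrow> dist z' z < d \<Longrightarrow> dist (case z' of (s, t) \<Rightarrow> Q s t) (case z of (s, t) \<Rightarrow> Q s t) < e"
    using \<open>0 < e\<close> unfolding uniformly_continuous_on_def by metis
  have "\<bar>Q s t - Q s' t\<bar> \<le> e" if "s \<in> K1" "s' \<in> K1" "t \<in> K2" "dist s s' < d" for s s' t
    using d(2)[of "(s', t)" "(s, t)"] that by (simp add: dist_Pair_Pair dist_real_def)
  with d(1) show ?thesis by (rule that)
qed

lemma continuous_on_integral_section:
  fixes Q :: "'a::metric_space \<Rightarrow> 'b::metric_space \<Rightarrow> real"
  assumes K: "compact K1" "compact K2" and Q: "continuous_on (K1 \<times> K2) (\<lambda>(s, t). Q s t)"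
    and \<nu>: "\<nu> \<in> borel_probs K2"
  shows "continuous_on K1 (\<lambda>s. \<integral>t. Q s t \<partial>\<nu>)"
  unfolding continuous_on_iff
proof (intro ballI allI impI)
  fix s e assume s: "s \<in> K1" and e: "(0::real) < e"
  obtain d where d: "0 < d"
    "\<And>s s' t. s \<in> K1 \<Longrightarrow> s' \<in> K1 \<Longrightarrow> t \<in> K2 \<Longrightarrow> dist s s' < d \<Longrightarrow> \<bar>Q s t - Q s' t\<bar> \<le> e/2"
    using equicontinuous_sections[OF K Q, of "e/2"] e by auto
  have "dist (\<integral>t. Q s' t \<partial>\<nu>) (\<integral>t. Q s t \<partial>\<nu>) < e" if "s' \<in> K1" "dist s' s < d" for s'
  proof -
    have "\<bar>(\<integral>t. Q s' t \<partial>\<nu>) - (\<integral>t. Q s t \<partial>\<nu>)\<bar> \<le> e/2"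
      using d(2) s that by (intro borel_probs_abs_integral_diff_le[OF \<nu> K(2)] continuous_on_section[OF Q]) auto
    then show ?thesis using e by (simp add: dist_real_def)
  qed
  then show "\<exists>d>0. \<forall>x'\<in>K1. dist x' s < d \<longrightarrow> dist (\<integral>t. Q x' t \<partial>\<nu>) (\<integral>t. Q s t \<partial>\<nu>) < e"
    using d(1) by blast
qed

text \<open>Both measures move at once. The inner integrals converge pointwise by weak convergence
  and are equicontinuous, so a finite net makes the convergence uniform; the outer measure then sees
  a vanishing error plus a fixed continuous integrand.\<close>

lemma dbl_int_tendsto:
  fixes Q :: "'a::metric_space \<Rightarrow> 'a \<Rightarrow> real"
  assumes K: "compact K1" "compact K2" and Q: "continuous_on (K1 \<times> K2) (\<lambda>(s, t). Q s t)"
    and mem: "\<And>n. \<mu> n \<in> borel_probs K1" "\<And>n. \<nu> n \<in> borel_probs K2" "\<nu>' \<in> borel_probs K2"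
    and lim: "weak_tendsto K1 \<mu> \<mu>'" "weak_tendsto K2 \<nu> \<nu>'"
  shows "(\<lambda>n. dbl_int Q (\<mu> n) (\<nu> n)) \<longlonglongrightarrow> dbl_int Q \<mu>' \<nu>'"
proof -
  define G where "G n s = (\<integral>t. Q s t \<partial>\<nu> n)" for n s
  define G' where "G' s = (\<integral>t. Q s t \<partial>\<nu>')" for s
  have cG: "continuous_on K1 (G n)" for n
    unfolding G_def by (rule continuous_on_integral_section[OF K Q mem(2)])
  have cG': "continuous_on K1 G'"
    unfolding G'_def by (rule continuous_on_integral_section[OF K Q mem(3)])
  have Gs: "(\<lambda>n. G n s) \<longlonglongrightarrow> G' s" if "s \<in> K1" for s
    using lim(2) continuous_on_section[OF Q that] unfolding weak_tendsto_def G_def G'_def by blast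
  have "(\<lambda>n. (\<integral>s. G n s \<partial>\<mu> n) - (\<integral>s. G' s \<partial>\<mu> n)) \<longlonglongrightarrow> 0"
  proof (rule LIMSEQ_I)
    fix e :: real assume e: "0 < e"
    obtain d where d: "0 < d"
      "\<And>s s' t. s \<in> K1 \<Longrightarrow> s' \<in> K1 \<Longrightarrow> t \<in> K2 \<Longrightarrow> dist s s' < d \<Longrightarrow> \<bar>Q s t - Q s' t\<bar> \<le> e/4"
      using equicontinuous_sections[OF K Q, of "e/4"] e by auto
    have close: "\<bar>(\<integral>t. Q s t \<partial>\<rho>) - (\<integral>t. Q s' t \<partial>\<rho>)\<bar> \<le> e/4"
      if "s \<in> K1" "s' \<in> K1" "dist s s' < d" "\<rho> \<in> borel_probs K2" for s s' \<rho>
      using d(2) that by (intro borel_probs_abs_integral_diff_le[OF _ K(2)] continuous_on_section[OF Q]) auto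
    obtain F where F: "F \<subseteq> K1" "finite F" "K1 \<subseteq> (\<Union>x\<in>F. ball x d)"
      using compactE_image[OF K(1), of K1 "\<lambda>x. ball x d"] d(1) by force
    have "\<forall>s\<in>F. \<forall>\<^sub>F n in sequentially. dist (G n s) (G' s) < e/4"
      using Gs F(1) e by (intro ballI tendstoD) auto
    then have "\<forall>\<^sub>F n in sequentially. \<forall>s\<in>F. dist (G n s) (G' s) < e/4"
      using F(2) by (simp add: eventually_ball_finite)
    then obtain N where N: "\<And>n s. n \<ge> N \<Longrightarrow> s \<in> F \<Longrightarrow> dist (G n s) (G' s) < e/4"
      unfolding eventually_sequentially by blast
    have "norm ((\<integral>s. G n s \<partial>\<mu> n) - (\<integral>s. G' s \<partial>\<mu> n) - 0) < e" if n: "n \<ge> N" for n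
    proof -
      \<comment> \<open>Three errors of \<open>e/4\<close>: from \<open>s\<close> to the net point
        under \<open>\<nu> n\<close>, at the net point, and back under \<open>\<nu>'\<close>; the
        fourth quarter makes the final bound strict.\<close>
      have "\<bar>G n s - G' s\<bar> \<le> 3 * (e/4)" if s: "s \<in> K1" for s
      proof -
        obtain x where x: "x \<in> F" "dist x s < d" using F(3) s by auto
        then have xK: "x \<in> K1" using F(1) by auto
        have "\<bar>G n x - G n s\<bar> \<le> e/4" "\<bar>G' x - G' s\<bar> \<le> e/4"
          unfolding G_def G'_def using close[OF xK s x(2)] mem by auto
        then show ?thesis using N[OF n x(1)] unfolding dist_real_def by linarith
      qed
      then have "\<bar>(\<integral>s. G n s \<partial>\<mu> n) - (\<integral>s. G' s \<partial>\<mu> n)\<bar> \<le> 3 * (e/4)"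
        by (rule borel_probs_abs_integral_diff_le[OF mem(1) K(1) cG cG'])
      then show ?thesis using e by simp
    qed
    then show "\<exists>no. \<forall>n\<ge>no. norm ((\<integral>s. G n s \<partial>\<mu> n) - (\<integral>s. G' s \<partial>\<mu> n) - 0) < e" by blast
  qed
  moreover have "(\<lambda>n. \<integral>s. G' s \<partial>\<mu> n) \<longlonglongrightarrow> (\<integral>s. G' s \<partial>\<mu>')"
    using lim(1) cG' unfolding weak_tendsto_def by blast
  ultimately have "(\<lambda>n. (\<integral>s. G n s \<partial>\<mu> n) - (\<integral>s. G' s \<partial>\<mu> n) + (\<integral>s. G' s \<partial>\<mu> n)) \<longlonglongrightarrow> 0 + (\<integral>s. G' s \<partial>\<mu>')"
    by (rule tendsto_add)
  then show ?thesis by (simp add: dbl_int_def G_def G'_def)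
qed

text \<open>The weights are a function on the whole type, zero off \<open>F\<close>, so that two
  such measures can be summed over a common finite set. The measure is described by its integrals of
  continuous functions, the only form in which it enters.\<close>

definition discrete_on :: "'a::topological_space set \<Rightarrow> 'a measure \<Rightarrow> 'a set \<Rightarrow> ('a \<Rightarrow> real) \<Rightarrow> bool" where
  "discrete_on K \<mu> F w \<longleftrightarrow> \<mu> \<in> borel_probs K \<and> finite F \<and> F \<subseteq> K \<and> (\<forall>x. x \<notin> F \<longrightarrow> w x = 0) \<and>
     (\<forall>h::'a \<Rightarrow> real. continuous_on K h \<longrightarrow> (\<integral>x. h x \<partial>\<mu>) = (\<Sum>x\<in>F. w x * h x))"

text \<open>Push forward under a measurable map that sends each point to a net point within
  \<open>inverse (Suc n)\<close>; the maps converge to the identity, so dominated convergence yields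
  the weak limit.\<close>

lemma borel_probs_discretize:
  fixes K :: "'a::polish_space set"
  assumes K: "compact K" and \<mu>: "\<mu> \<in> borel_probs K"
  obtains \<nu> where "\<And>n. \<exists>F w. discrete_on K (\<nu> n) F w" "weak_tendsto K \<nu> \<mu>"
proof -
  interpret prob_space \<mu> using borel_probsD[OF \<mu>(1)] by simp
  have spc: "space \<mu> = K" by (rule borel_probsD(3)[OF \<mu>])
  have sts[measurable_cong]: "sets \<mu> = sets (restrict_space borel K)" by (rule borel_probsD(2)[OF \<mu>])
  have "K \<noteq> {}" using not_empty spc by simp
  have "\<exists>F. finite F \<and> F \<subseteq> K \<and> K \<subseteq> (\<Union>x\<in>F. ball x (inverse (Suc n)))" for n
    using compactE_image[OF K, of K "\<lambda>x. ball x (inverse (Suc n))"] by force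
  then obtain F where F: "\<And>n. finite (F n)" "\<And>n. F n \<subseteq> K" "\<And>n. K \<subseteq> (\<Union>x\<in>F n. ball x (inverse (Suc n)))"
    by metis
  have Fne: "F n \<noteq> {}" for n using F(3)[of n] \<open>K \<noteq> {}\<close> by auto
  \<comment> \<open>Several net points may be close enough; the least index in an enumeration is a
    measurable choice.\<close>
  define p where "p n x = from_nat_into (F n) (LEAST i. dist (from_nat_into (F n) i) x < inverse (Suc n))" for n x
  have pF: "p n x \<in> F n" for n x
    unfolding p_def using Fne by (rule from_nat_into)
  have pd: "dist (p n x) x < inverse (Suc n)" if "x \<in> K" for n x
  proof -
    obtain y where "y \<in> F n" "dist y x < inverse (Suc n)"
      using F(3)[of n] \<open>x \<in> K\<close> by auto
    then have "\<exists>i. dist (from_nat_into (F n) i) x < inverse (Suc n)"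
      using from_nat_into_surj[of "F n" y] F(1)[of n] by (metis countable_finite)
    then show ?thesis unfolding p_def by (rule LeastI_ex)
  qed
  have id[measurable]: "(\<lambda>x. x) \<in> borel_measurable \<mu>"
    using borel_probs_measurable[OF \<mu> continuous_on_id] by simp
  have pm: "p n \<in> \<mu> \<rightarrow>\<^sub>M restrict_space borel K" for n
  proof -
    have 1: "(\<lambda>x. LEAST i. dist (from_nat_into (F n) i) x < inverse (Suc n)) \<in> \<mu> \<rightarrow>\<^sub>M count_space UNIV"
      by measurable
    have 2: "from_nat_into (F n) \<in> count_space UNIV \<rightarrow>\<^sub>M restrict_space borel K"
      using from_nat_into[OF Fne[of n]] F(2)[of n] by (auto simp: space_restrict_space)
    show ?thesis
      unfolding p_def[abs_def] by (rule measurable_compose[OF 1 2])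
  qed
  define \<nu> where "\<nu> n = distr \<mu> (restrict_space borel K) (p n)" for n
  have int: "(\<integral>x. h x \<partial>\<nu> n) = (\<integral>x. h (p n x) \<partial>\<mu>)" if "continuous_on K h" for n and h :: "'a \<Rightarrow> real"
    unfolding \<nu>_def by (rule integral_distr_borel_probs[OF pm that])
  have "\<exists>F w. discrete_on K (\<nu> n) F w" for n
  proof -
    define A where "A y = {x\<in>space \<mu>. p n x = y}" for y
    have pm': "p n \<in> borel_measurable \<mu>"
      using pm[of n] by (rule measurable_restrict_space2_iff[THEN iffD1, THEN conjunct1])
    have A[measurable]: "A y \<in> sets \<mu>" for y
      unfolding A_def using pm' by measurable
    define w where "w y = (if y \<in> F n then measure \<mu> (A y) else 0)" for y
    have "(\<integral>x. h x \<partial>\<nu> n) = (\<Sum>y\<in>F n. w y * h y)" if h: "continuous_on K h" for h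
    proof -
      have "(\<integral>x. h x \<partial>\<nu> n) = (\<integral>x. (\<Sum>y\<in>F n. h y * indicator (A y) x) \<partial>\<mu>)"
        unfolding int[OF h]
      proof (rule Bochner_Integration.integral_cong)
        fix x assume "x \<in> space \<mu>"
        then have "(\<Sum>y\<in>F n. h y * indicator (A y) x) = (\<Sum>y\<in>F n. if y = p n x then h y else 0)"
          by (intro sum.cong) (auto simp: A_def indicator_def)
        then show "h (p n x) = (\<Sum>y\<in>F n. h y * indicator (A y) x)"
          using pF F(1)[of n] by simp
      qed simp
      also have "\<dots> = (\<Sum>y\<in>F n. \<integral>x. h y * indicator (A y) x \<partial>\<mu>)"
        by (intro Bochner_Integration.integral_sum) (auto simp: emeasure_eq_measure)
      also have "\<dots> = (\<Sum>y\<in>F n. w y * h y)"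
        using A by (intro sum.cong) (auto simp: w_def mult.commute sets.Int_space_eq2)
      finally show ?thesis .
    qed
    moreover have "\<nu> n \<in> borel_probs K"
      unfolding \<nu>_def using prob_space_axioms pm by (rule distr_in_borel_probs)
    ultimately show ?thesis
      using F(1)[of n] F(2)[of n] by (intro exI[of _ "F n"] exI[of _ w]) (auto simp: discrete_on_def w_def)
  qed
  moreover have "weak_tendsto K \<nu> \<mu>"
    unfolding weak_tendsto_def
  proof (intro allI impI)
    fix h :: "'a \<Rightarrow> real" assume h: "continuous_on K h"
    have "bounded (h ` K)"
      using K h by (intro compact_imp_bounded compact_continuous_image)
    then obtain b where b: "\<And>x. x \<in> K \<Longrightarrow> \<bar>h x\<bar> \<le> b"
      by (auto simp: bounded_iff)
    have hm: "h \<in> borel_measurable (restrict_space borel K)"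
      by (rule borel_measurable_continuous_on_restrict[OF h])
    have "(\<lambda>n. \<integral>x. h (p n x) \<partial>\<mu>) \<longlonglongrightarrow> (\<integral>x. h x \<partial>\<mu>)"
    proof (rule integral_dominated_convergence[where w = "\<lambda>_. b"])
      show "AE x in \<mu>. (\<lambda>n. h (p n x)) \<longlonglongrightarrow> h x"
      proof (rule AE_I2)
        fix x assume "x \<in> space \<mu>"
        then have x: "x \<in> K" by (simp add: spc)
        have "(\<lambda>n. p n x) \<longlonglongrightarrow> x"
          by (rule metric_tendsto_imp_tendsto[OF LIMSEQ_inverse_real_of_nat])
            (use pd[OF x] in \<open>auto intro!: always_eventually less_imp_le simp: dist_real_def\<close>)
        moreover have "p n x \<in> K" for n using pF F(2) by blast
        ultimately show "(\<lambda>n. h (p n x)) \<longlonglongrightarrow> h x"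
          using h x by (simp add: continuous_on_sequentially comp_def)
      qed
      show "h \<in> borel_measurable \<mu>" by (rule borel_probs_measurable[OF \<mu> h])
      show "(\<lambda>x. h (p n x)) \<in> borel_measurable \<mu>" for n
        by (rule measurable_compose[OF pm hm])
      show "AE x in \<mu>. norm (h (p n x)) \<le> b" for n
        using b[OF subsetD[OF F(2) pF]] by (intro AE_I2) simp
    qed simp
    then show "(\<lambda>n. \<integral>x. h x \<partial>\<nu> n) \<longlonglongrightarrow> (\<integral>x. h x \<partial>\<mu>)" by (simp add: int[OF h])
  qed
  ultimately show ?thesis by (rule that)
qed

lemma discrete_on_exists:
  fixes K :: "'a::t1_space set"
  assumes F: "finite F" "F \<subseteq> K" and w: "\<And>x. 0 \<le> w x" "\<And>x. x \<notin> F \<Longrightarrow> w x = 0" "(\<Sum>x\<in>F. w x) = 1"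
  obtains \<mu> where "discrete_on K \<mu> F w"
proof -
  let ?P = "point_measure F (\<lambda>x. ennreal (w x))"
  have id: "(\<lambda>x. x) \<in> ?P \<rightarrow>\<^sub>M restrict_space borel K"
    using F by (intro measurableI) (auto simp: space_restrict_space space_point_measure sets_point_measure)
  have P: "prob_space ?P"
    using F w by (intro prob_spaceI) (simp add: space_point_measure emeasure_point_measure_finite sum_ennreal)
  have "(\<integral>x. h x \<partial>distr ?P (restrict_space borel K) (\<lambda>x. x)) = (\<Sum>x\<in>F. w x * h x)"
    if "continuous_on K h" for h
    using F w by (simp add: integral_distr_borel_probs[OF id that] lebesgue_integral_point_measure_finite)
  then have "discrete_on K (distr ?P (restrict_space borel K) (\<lambda>x. x)) F w"
    using F w P id by (auto simp: discrete_on_def intro!: distr_in_borel_probs)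
  then show ?thesis by (rule that)
qed

lemma dbl_int_discrete:
  assumes \<mu>: "discrete_on K1 \<mu> F w" and \<nu>: "discrete_on K2 \<nu> G v"
    and Q: "continuous_on (K1 \<times> K2) (\<lambda>(s, t). Q s t)"
    and U: "finite U" "F \<subseteq> U" "G \<subseteq> U"
  shows "dbl_int Q \<mu> \<nu> = (\<Sum>s\<in>U. \<Sum>t\<in>U. w s * v t * Q s t)"
proof -
  have F: "F \<subseteq> K1" "G \<subseteq> K2" and z: "\<And>x. x \<notin> F \<Longrightarrow> w x = 0" "\<And>x. x \<notin> G \<Longrightarrow> v x = 0"
    and spc: "space \<mu> = K1"
    using \<mu> \<nu> borel_probsD(3)[of \<mu> K1] by (auto simp: discrete_on_def)
  have "dbl_int Q \<mu> \<nu> = (\<integral>s. (\<Sum>t\<in>G. v t * Q s t) \<partial>\<mu>)"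
    unfolding dbl_int_def using \<nu> continuous_on_section[OF Q]
    by (intro Bochner_Integration.integral_cong) (auto simp: discrete_on_def spc)
  also have "\<dots> = (\<Sum>s\<in>F. w s * (\<Sum>t\<in>G. v t * Q s t))"
  proof -
    have "continuous_on K1 (\<lambda>s. Q s t)" if "t \<in> G" for t
    proof -
      have "continuous_on K1 (\<lambda>s. (s, t))" by (intro continuous_intros)
      from continuous_on_compose2[OF Q this] show ?thesis using that F by auto
    qed
    then have "continuous_on K1 (\<lambda>s. \<Sum>t\<in>G. v t * Q s t)"
      by (intro continuous_intros)
    then show ?thesis using \<mu> by (simp add: discrete_on_def)
  qed
  also have "\<dots> = (\<Sum>s\<in>F. \<Sum>t\<in>G. w s * v t * Q s t)"
    by (simp add: sum_distrib_left mult.assoc)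
  also have "\<dots> = (\<Sum>s\<in>F. \<Sum>t\<in>U. w s * v t * Q s t)"
    using U z by (intro sum.cong refl sum.mono_neutral_left) auto
  also have "\<dots> = (\<Sum>s\<in>U. \<Sum>t\<in>U. w s * v t * Q s t)"
    using U z by (intro sum.mono_neutral_left) auto
  finally show ?thesis .
qed

section \<open>Positive semidefinite kernels\<close>

definition psd_kernel :: "'a set \<Rightarrow> ('a \<Rightarrow> 'a \<Rightarrow> real) \<Rightarrow> bool" where
  "psd_kernel T Q \<longleftrightarrow> (\<forall>s\<in>T. \<forall>t\<in>T. Q s t = Q t s) \<and>
     (\<forall>F c. finite F \<longrightarrow> F \<subseteq> T \<longrightarrow> 0 \<le> (\<Sum>s\<in>F. \<Sum>t\<in>F. c s * c t * Q s t))"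

lemma quadratic_form_diff:
  fixes w v :: "'a \<Rightarrow> real"
  assumes "\<And>s t. s \<in> U \<Longrightarrow> t \<in> U \<Longrightarrow> Q s t = Q t s"
  shows "(\<Sum>s\<in>U. \<Sum>t\<in>U. (p * w s - q * v s) * (p * w t - q * v t) * Q s t)
    = p\<^sup>2 * (\<Sum>s\<in>U. \<Sum>t\<in>U. w s * w t * Q s t) - 2 * p * q * (\<Sum>s\<in>U. \<Sum>t\<in>U. w s * v t * Q s t)
      + q\<^sup>2 * (\<Sum>s\<in>U. \<Sum>t\<in>U. v s * v t * Q s t)"
proof -
  have "(\<Sum>s\<in>U. \<Sum>t\<in>U. v s * w t * Q s t) = (\<Sum>t\<in>U. \<Sum>s\<in>U. v s * w t * Q s t)"
    by (rule sum.swap)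
  also have "\<dots> = (\<Sum>s\<in>U. \<Sum>t\<in>U. w s * v t * Q s t)"
    using assms by (intro sum.cong refl) (auto simp: mult.commute)
  finally have swap: "(\<Sum>s\<in>U. \<Sum>t\<in>U. v s * w t * Q s t) = (\<Sum>s\<in>U. \<Sum>t\<in>U. w s * v t * Q s t)" .
  have "(\<Sum>s\<in>U. \<Sum>t\<in>U. (p * w s - q * v s) * (p * w t - q * v t) * Q s t)
    = (\<Sum>s\<in>U. \<Sum>t\<in>U. p\<^sup>2 * (w s * w t * Q s t) - p * q * (w s * v t * Q s t) - p * q * (v s * w t * Q s t)
        + q\<^sup>2 * (v s * v t * Q s t))"
    by (intro sum.cong refl) (simp add: power2_eq_square algebra_simps)
  also have "\<dots> = p\<^sup>2 * (\<Sum>s\<in>U. \<Sum>t\<in>U. w s * w t * Q s t) - p * q * (\<Sum>s\<in>U. \<Sum>t\<in>U. w s * v t * Q s t)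
      - p * q * (\<Sum>s\<in>U. \<Sum>t\<in>U. v s * w t * Q s t) + q\<^sup>2 * (\<Sum>s\<in>U. \<Sum>t\<in>U. v s * v t * Q s t)"
    by (simp only: sum.distrib sum_subtractf sum_distrib_left)
  finally show ?thesis by (simp add: swap)
qed

lemma psd_kernel_dbl_int:
  fixes Q :: "'a::polish_space \<Rightarrow> 'a \<Rightarrow> real"
  assumes psd: "psd_kernel T Q" and Q: "continuous_on (T \<times> T) (\<lambda>(s, t). Q s t)"
    and K: "compact K1" "compact K2" "K1 \<subseteq> T" "K2 \<subseteq> T"
    and \<mu>: "\<mu> \<in> borel_probs K1" and \<nu>: "\<nu> \<in> borel_probs K2"
  shows "0 \<le> p\<^sup>2 * dbl_int Q \<mu> \<mu> - 2 * p * q * dbl_int Q \<mu> \<nu> + q\<^sup>2 * dbl_int Q \<nu> \<nu>"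
proof -
  obtain m where m: "\<And>n. \<exists>F w. discrete_on K1 (m n) F w" "weak_tendsto K1 m \<mu>"
    using borel_probs_discretize[OF K(1) \<mu>] by metis
  obtain m' where m': "\<And>n. \<exists>F w. discrete_on K2 (m' n) F w" "weak_tendsto K2 m' \<nu>"
    using borel_probs_discretize[OF K(2) \<nu>] by metis
  have mem: "m n \<in> borel_probs K1" "m' n \<in> borel_probs K2" for n
    using m(1)[of n] m'(1)[of n] by (auto simp: discrete_on_def)
  have cQ: "continuous_on (A \<times> B) (\<lambda>(s, t). Q s t)" if "A \<subseteq> T" "B \<subseteq> T" for A B
    using Q by (rule continuous_on_subset) (use that in auto)
  have "(\<lambda>n. p\<^sup>2 * dbl_int Q (m n) (m n) - 2 * p * q * dbl_int Q (m n) (m' n) + q\<^sup>2 * dbl_int Q (m' n) (m' n))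
    \<longlonglongrightarrow> p\<^sup>2 * dbl_int Q \<mu> \<mu> - 2 * p * q * dbl_int Q \<mu> \<nu> + q\<^sup>2 * dbl_int Q \<nu> \<nu>"
    using K \<mu> \<nu> mem m(2) m'(2) by (intro tendsto_intros dbl_int_tendsto[OF _ _ cQ])
  moreover have "0 \<le> p\<^sup>2 * dbl_int Q (m n) (m n) - 2 * p * q * dbl_int Q (m n) (m' n) + q\<^sup>2 * dbl_int Q (m' n) (m' n)" for n
  proof -
    obtain F w where F: "discrete_on K1 (m n) F w" using m(1) by blast
    obtain G v where G: "discrete_on K2 (m' n) G v" using m'(1) by blast
    \<comment> \<open>Over the union of the supports the two measures become one signed coefficient
      function \<open>p * w - q * v\<close>, to which positivity on finite sets applies, whether or
      not the supports overlap.\<close>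
    define U where "U = F \<union> G"
    have U: "finite U" "F \<subseteq> U" "G \<subseteq> U" "U \<subseteq> T"
      using F G K by (auto simp: U_def discrete_on_def)
    have sym: "Q s t = Q t s" if "s \<in> U" "t \<in> U" for s t
      using psd that U(4) unfolding psd_kernel_def by blast
    have "0 \<le> (\<Sum>s\<in>U. \<Sum>t\<in>U. (p * w s - q * v s) * (p * w t - q * v t) * Q s t)"
      using psd U unfolding psd_kernel_def by (auto dest!: spec[of _ U] spec[of _ "\<lambda>s. p * w s - q * v s"])
    also have "\<dots> = p\<^sup>2 * dbl_int Q (m n) (m n) - 2 * p * q * dbl_int Q (m n) (m' n) + q\<^sup>2 * dbl_int Q (m' n) (m' n)"
      unfolding dbl_int_discrete[OF F F cQ[OF K(3) K(3)] U(1,2,2)]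
        dbl_int_discrete[OF F G cQ[OF K(3) K(4)] U(1,2,3)]
        dbl_int_discrete[OF G G cQ[OF K(4) K(4)] U(1,3,3)]
      by (rule quadratic_form_diff[OF sym])
    finally show ?thesis .
  qed
  ultimately show ?thesis by (intro LIMSEQ_le_const) auto
qed

section \<open>Gaussian random variables\<close>

lemma (in prob_space) gaussian_rv_L2:
  assumes "gaussian_rv M Y"
  shows "Y \<in> L2 M"
proof -
  have Y[measurable]: "Y \<in> borel_measurable M" using assms by (simp add: gaussian_rv_def)
  from assms consider m s where "0 < s" "distributed M lborel Y (normal_density m s)"
    | m where "AE \<omega> in M. Y \<omega> = m"
    unfolding gaussian_rv_def by blast
  then show ?thesis
  proof cases
    case 1
    have "integrable lborel (\<lambda>x. normal_density m s x * (x - m)\<^sup>2)"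
      by (rule integrable_normal_moment[OF 1(1)])
    then have "integrable M (\<lambda>\<omega>. (Y \<omega> - m)\<^sup>2)"
      by (subst (asm) distributed_integrable[OF 1(2)]) auto
    then have "(\<lambda>\<omega>. Y \<omega> - m) \<in> L2 M" by (simp add: L2_def)
    moreover have "(\<lambda>\<omega>. m) \<in> L2 M" by (simp add: L2_def)
    ultimately show ?thesis using L2_add[of "\<lambda>\<omega>. Y \<omega> - m" M "\<lambda>\<omega>. m"] by simp
  next
    case 2
    then have "AE \<omega> in M. (Y \<omega>)\<^sup>2 = m\<^sup>2" by eventually_elim simp
    then have "integrable M (\<lambda>\<omega>. (Y \<omega>)\<^sup>2)"
      by (subst integrable_cong_AE) auto
    then show ?thesis by (simp add: L2_def)
  qed
qed

lemma integral_cos_std_normal: "(\<integral>x. cos (t * x) \<partial>std_normal_distribution) = exp (- t\<^sup>2 / 2)"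
proof -
  interpret N: real_distribution std_normal_distribution by (rule real_dist_normal_dist)
  have "integrable std_normal_distribution (\<lambda>x. iexp (t * x))"
    by (intro N.integrable_const_bound[of _ 1]) (auto simp: norm_exp_i_times)
  then have "Re (char std_normal_distribution t) = (\<integral>x. Re (iexp (t * x)) \<partial>std_normal_distribution)"
    unfolding char_def by (simp only: integral_Re)
  then show ?thesis
    by (simp add: char_std_normal_distribution Re_exp)
qed

lemma (in prob_space) gaussian_rv_expectation_cos:
  assumes "gaussian_rv M Y" "expectation Y = 0"
  shows "expectation (\<lambda>\<omega>. cos (Y \<omega>)) = exp (- ip M Y Y / 2)"
proof -
  have Y[measurable]: "Y \<in> borel_measurable M" using assms by (simp add: gaussian_rv_def)
  from assms consider m s where "0 < s" "distributed M lborel Y (normal_density m s)"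
    | m where "AE \<omega> in M. Y \<omega> = m"
    unfolding gaussian_rv_def by blast
  then show ?thesis
  proof cases
    case 1
    have m: "m = 0" using normal_distributed_expectation[OF 1] assms(2) by simp
    have s: "ip M Y Y = s\<^sup>2" using normal_distributed_variance[OF 1] assms(2) by (simp add: ip_self)
    have "distributed M lborel (\<lambda>\<omega>. Y \<omega> / s) std_normal_density"
      using 1 m normal_standard_normal_convert[OF 1(1), of Y 0] by simp
    then have d: "distr M lborel (\<lambda>\<omega>. Y \<omega> / s) = std_normal_distribution"
      by (rule distributed_distr_eq_density)
    have "expectation (\<lambda>\<omega>. cos (Y \<omega>)) = expectation (\<lambda>\<omega>. cos (s * (Y \<omega> / s)))"
      using 1(1) by simp
    also have "\<dots> = (\<integral>x. cos (s * x) \<partial>distr M lborel (\<lambda>\<omega>. Y \<omega> / s))"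
      by (intro integral_distr[symmetric]) auto
    also have "\<dots> = exp (- s\<^sup>2 / 2)"
      unfolding d by (rule integral_cos_std_normal)
    finally show ?thesis by (simp add: s)
  next
    case 2
    \<comment> \<open>A constant with mean zero vanishes almost surely, so both sides are 1.\<close>
    have "expectation Y = expectation (\<lambda>_. m)"
      using 2 by (intro integral_cong_AE) auto
    then have "m = 0" using assms(2) by (simp add: prob_space)
    then have AE: "AE \<omega> in M. Y \<omega> = 0" using 2 by simp
    have "ip M Y Y = expectation (\<lambda>_. 0)"
      unfolding ip_def using AE by (intro integral_cong_AE) auto
    moreover have "expectation (\<lambda>\<omega>. cos (Y \<omega>)) = expectation (\<lambda>_. 1)"
      using AE by (intro integral_cong_AE) auto
    ultimately show ?thesis by (simp add: prob_space)
  qed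
qed

text \<open>Pathwise convergence alone provides no integrable bound for
  \<open>(f n - g)\<^sup>2\<close>. The cosine is bounded, so its expectations converge, and for a
  centered Gaussian difference the logarithm recovers the variance.\<close>

lemma (in prob_space) gaussian_L2_tendsto:
  assumes gauss: "\<And>n. gaussian_rv M (\<lambda>\<omega>. f n \<omega> - g \<omega>)" and mean: "\<And>n. expectation (\<lambda>\<omega>. f n \<omega> - g \<omega>) = 0"
    and lim: "\<And>\<omega>. \<omega> \<in> space M \<Longrightarrow> (\<lambda>n. f n \<omega>) \<longlonglongrightarrow> g \<omega>"
  shows "L2_tendsto M f g"
proof -
  have [measurable]: "(\<lambda>\<omega>. f n \<omega> - g \<omega>) \<in> borel_measurable M" for n
    using gauss[of n] by (simp add: gaussian_rv_def)
  have "(\<lambda>n. expectation (\<lambda>\<omega>. cos (f n \<omega> - g \<omega>))) \<longlonglongrightarrow> expectation (\<lambda>\<omega>. 1)"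
  proof (rule integral_dominated_convergence[where w = "\<lambda>_. 1"])
    show "AE \<omega> in M. (\<lambda>n. cos (f n \<omega> - g \<omega>)) \<longlonglongrightarrow> 1"
    proof (rule AE_I2)
      fix \<omega> assume "\<omega> \<in> space M"
      then have "(\<lambda>n. cos (f n \<omega> - g \<omega>)) \<longlonglongrightarrow> cos (g \<omega> - g \<omega>)"
        by (intro tendsto_intros lim)
      then show "(\<lambda>n. cos (f n \<omega> - g \<omega>)) \<longlonglongrightarrow> 1" by simp
    qed
  qed auto
  then have "(\<lambda>n. exp (- ip M (\<lambda>\<omega>. f n \<omega> - g \<omega>) (\<lambda>\<omega>. f n \<omega> - g \<omega>) / 2)) \<longlonglongrightarrow> 1"
    by (simp add: gaussian_rv_expectation_cos[OF gauss mean] prob_space)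
  then have "(\<lambda>n. ln (exp (- ip M (\<lambda>\<omega>. f n \<omega> - g \<omega>) (\<lambda>\<omega>. f n \<omega> - g \<omega>) / 2))) \<longlonglongrightarrow> ln 1"
    by (intro tendsto_intros) auto
  then have "(\<lambda>n. - ip M (\<lambda>\<omega>. f n \<omega> - g \<omega>) (\<lambda>\<omega>. f n \<omega> - g \<omega>) / 2) \<longlonglongrightarrow> 0"
    by simp
  from tendsto_mult[OF this tendsto_const[of "-2"]] show ?thesis
    by (simp add: L2_tendsto_def)
qed

text \<open>Repeated points are merged by adding their coefficients. Non-emptiness of
  \<open>T\<close> supplies a point for the zero combination, as the indexed form has at least one
  summand.\<close>

lemma finite_combinations_iff:
  assumes "T \<noteq> {}"
  shows "Y \<in> finite_combinations T X \<longleftrightarrow> (\<exists>F c. finite F \<and> F \<subseteq> T \<and> Y = (\<lambda>\<omega>. \<Sum>x\<in>F. c x * X x \<omega>))"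
proof
  assume "Y \<in> finite_combinations T X"
  then obtain k :: nat and a :: "nat \<Rightarrow> real" and t where
    Y: "Y = (\<lambda>\<omega>. \<Sum>j=1..k. a j * X (t j) \<omega>)" and t: "\<forall>j\<in>{1..k}. t j \<in> T"
    by (auto simp: finite_combinations_def)
  have "Y = (\<lambda>\<omega>. \<Sum>x\<in>t ` {1..k}. (\<Sum>j\<in>{j\<in>{1..k}. t j = x}. a j) * X x \<omega>)"
  proof
    fix \<omega>
    have "Y \<omega> = (\<Sum>x\<in>t ` {1..k}. \<Sum>j\<in>{j\<in>{1..k}. t j = x}. a j * X (t j) \<omega>)"
      unfolding Y by (rule sum.image_gen) simp
    also have "\<dots> = (\<Sum>x\<in>t ` {1..k}. (\<Sum>j\<in>{j\<in>{1..k}. t j = x}. a j) * X x \<omega>)"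
      by (intro sum.cong refl) (simp add: sum_distrib_right)
    finally show "Y \<omega> = (\<Sum>x\<in>t ` {1..k}. (\<Sum>j\<in>{j\<in>{1..k}. t j = x}. a j) * X x \<omega>)" .
  qed
  moreover have "finite (t ` {1..k})" "t ` {1..k} \<subseteq> T" using t by auto
  ultimately show "\<exists>F c. finite F \<and> F \<subseteq> T \<and> Y = (\<lambda>\<omega>. \<Sum>x\<in>F. c x * X x \<omega>)"
    by (intro exI[of _ "t ` {1..k}"] exI[of _ "\<lambda>x. \<Sum>j\<in>{j\<in>{1..k}. t j = x}. a j"]) auto
next
  assume "\<exists>F c. finite F \<and> F \<subseteq> T \<and> Y = (\<lambda>\<omega>. \<Sum>x\<in>F. c x * X x \<omega>)"
  then obtain F c where F: "finite F" "F \<subseteq> T" and Y: "Y = (\<lambda>\<omega>. \<Sum>x\<in>F. c x * X x \<omega>)" by blast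
  show "Y \<in> finite_combinations T X"
  proof (cases "F = {}")
    case True
    obtain t where "t \<in> T" using assms by auto
    then have "Y = (\<lambda>\<omega>. \<Sum>j=1..1::nat. 0 * X t \<omega>) \<and> 1 \<le> (1::nat) \<and> (\<forall>j\<in>{1..1::nat}. t \<in> T)"
      using True Y by simp
    then show ?thesis unfolding finite_combinations_def
      by (intro CollectI exI[of _ "1::nat"] exI[of _ "\<lambda>_. 0"] exI[of _ "\<lambda>_. t"]) simp
  next
    case False
    obtain h where h: "bij_betw h {1..card F} F"
      using ex_bij_betw_nat_finite_1[OF F(1)] by blast
    have "Y = (\<lambda>\<omega>. \<Sum>j=1..card F. c (h j) * X (h j) \<omega>)"
      unfolding Y using sum.reindex_bij_betw[OF h, of "\<lambda>x. c x * X x _"] by auto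
    moreover have "1 \<le> card F" using F False by (simp add: Suc_le_eq card_gt_0_iff)
    moreover have "\<forall>j\<in>{1..card F}. h j \<in> T" using h F by (auto simp: bij_betw_def)
    ultimately show ?thesis unfolding finite_combinations_def
      by (intro CollectI exI[of _ "card F"] exI[of _ "\<lambda>j. c (h j)"] exI[of _ h]) simp
  qed
qed

section \<open>Duality\<close>

text \<open>The Hilbert-space content of the problem: mean-square continuity of the field and the
  covariance as inner product. \<open>gaussian_l2_field\<close> derives both from Gaussianity and
  continuous paths.\<close>

locale l2_field = prob_space M for M :: "'a measure" +
  fixes T :: "'t::polish_space set" and X :: "'t \<Rightarrow> 'a \<Rightarrow> real" and R :: "'t \<Rightarrow> 't \<Rightarrow> real"
    and K1 K2 :: "'t set" and r :: real
  assumes X_L2: "\<And>t. t \<in> T \<Longrightarrow> X t \<in> L2 M"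
    and X_tendsto: "\<And>u t. (\<And>n. u n \<in> T) \<Longrightarrow> t \<in> T \<Longrightarrow> u \<longlonglongrightarrow> t \<Longrightarrow> L2_tendsto M (\<lambda>n. X (u n)) (X t)"
    and R_eq: "\<And>s t. s \<in> T \<Longrightarrow> t \<in> T \<Longrightarrow> R s t = ip M (X s) (X t)"
    and K1: "compact K1" "K1 \<noteq> {}" "K1 \<subseteq> T"
    and K2: "compact K2" "K2 \<noteq> {}" "K2 \<subseteq> T"
    and r_pos: "0 < r"
begin

definition comb :: "'t set \<Rightarrow> ('t \<Rightarrow> real) \<Rightarrow> 'a \<Rightarrow> real" where
  "comb F c = (\<lambda>\<omega>. \<Sum>x\<in>F. c x * X x \<omega>)"

lemma comb_L2: "F \<subseteq> T \<Longrightarrow> comb F c \<in> L2 M"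
  unfolding comb_def by (intro L2_sum L2_scale X_L2) auto

lemma finite_combinations_comb:
  "Y \<in> finite_combinations T X \<longleftrightarrow> (\<exists>F c. finite F \<and> F \<subseteq> T \<and> Y = comb F c)"
  using finite_combinations_iff[of T Y X] K1 by (auto simp: comb_def)

lemma comb_superset:
  assumes "finite G" "F \<subseteq> G" "\<And>x. x \<in> G - F \<Longrightarrow> c x = 0"
  shows "comb F c = comb G c"
  unfolding comb_def using assms by (intro ext sum.mono_neutral_left) auto

lemma ip_comb_left:
  assumes "F \<subseteq> T" "H \<in> L2 M"
  shows "ip M (comb F c) H = (\<Sum>x\<in>F. c x * ip M (X x) H)"
proof -
  have "(\<lambda>\<omega>. c x * X x \<omega>) \<in> L2 M" if "x \<in> F" for x
    using that assms by (intro L2_scale X_L2) auto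
  then show ?thesis
    unfolding comb_def using assms(2) by (simp add: ip_sum_left ip_scale_left)
qed

lemma ip_comb_comb:
  assumes "F \<subseteq> T"
  shows "ip M (comb F c) (comb F c) = (\<Sum>s\<in>F. \<Sum>t\<in>F. c s * c t * R s t)"
proof -
  have "ip M (X s) (comb F c) = (\<Sum>t\<in>F. c t * R s t)" if "s \<in> F" for s
    using assms that X_L2 ip_comb_left[of F "X s" c]
    by (auto simp: ip_commute[of M "X s"] R_eq subset_iff intro!: sum.cong)
  then have "ip M (comb F c) (comb F c) = (\<Sum>s\<in>F. c s * (\<Sum>t\<in>F. c t * R s t))"
    using ip_comb_left[OF assms comb_L2[OF assms, of c], of c] by simp
  then show ?thesis by (simp add: sum_distrib_left mult.assoc)
qed

lemma comb_lincomb: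
  assumes "finite F" "finite G" "\<And>x. x \<notin> F \<Longrightarrow> c x = 0" "\<And>x. x \<notin> G \<Longrightarrow> d x = 0"
  shows "(\<lambda>\<omega>. a * comb F c \<omega> + b * comb G d \<omega>) = comb (F \<union> G) (\<lambda>x. a * c x + b * d x)"
proof -
  have "comb F c = comb (F \<union> G) c" "comb G d = comb (F \<union> G) d"
    using assms by (auto intro!: comb_superset)
  then show ?thesis
    by (simp add: comb_def sum_distrib_left sum.distrib[symmetric] distrib_right mult.assoc)
qed

lemma ms_closure_L2: "H \<in> ms_closure M T X \<Longrightarrow> H \<in> L2 M"
  by (simp add: ms_closure_def L2_def)

lemma ms_closure_ip:
  "H \<in> ms_closure M T X \<longleftrightarrow> H \<in> L2 M \<and>
     (\<forall>e>0. \<exists>F c. finite F \<and> F \<subseteq> T \<and> ip M (\<lambda>\<omega>. H \<omega> - comb F c \<omega>) (\<lambda>\<omega>. H \<omega> - comb F c \<omega>) < e)"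
  unfolding ms_closure_def L2_def ip_self Bex_def finite_combinations_comb by blast

lemma ms_closure_lincomb:
  assumes H: "H \<in> ms_closure M T X" and H': "H' \<in> ms_closure M T X"
  shows "(\<lambda>\<omega>. a * H \<omega> + b * H' \<omega>) \<in> ms_closure M T X"
  unfolding ms_closure_ip
proof (intro conjI allI impI)
  note L = ms_closure_L2[OF H] ms_closure_L2[OF H']
  show "(\<lambda>\<omega>. a * H \<omega> + b * H' \<omega>) \<in> L2 M" by (intro L2_add L2_scale L)
  fix e :: real assume e: "0 < e"
  \<comment> \<open>Fits the bound
    \<open>2 * a\<^sup>2 * ip M u u + 2 * b\<^sup>2 * ip M v v\<close> for the error; the summand 1
    covers \<open>a = b = 0\<close> and makes the final inequality strict.\<close>
  define \<delta> where "\<delta> = e / (2 * a\<^sup>2 + 2 * b\<^sup>2 + 1)"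
  have pos: "0 < 2 * a\<^sup>2 + 2 * b\<^sup>2 + 1" by (simp add: add_nonneg_pos)
  then have \<delta>: "0 < \<delta>" using e by (simp add: \<delta>_def)
  obtain F c where F: "finite F" "F \<subseteq> T" "ip M (\<lambda>\<omega>. H \<omega> - comb F c \<omega>) (\<lambda>\<omega>. H \<omega> - comb F c \<omega>) < \<delta>"
    using H \<delta> unfolding ms_closure_ip by blast
  obtain G d where G: "finite G" "G \<subseteq> T" "ip M (\<lambda>\<omega>. H' \<omega> - comb G d \<omega>) (\<lambda>\<omega>. H' \<omega> - comb G d \<omega>) < \<delta>"
    using H' \<delta> unfolding ms_closure_ip by blast
  \<comment> \<open>\<open>comb_lincomb\<close> needs coefficients that vanish off the
    supports.\<close>
  define c' where "c' x = (if x \<in> F then c x else 0)" for x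
  define d' where "d' x = (if x \<in> G then d x else 0)" for x
  have cd: "comb F c = comb F c'" "comb G d = comb G d'"
    by (auto simp: comb_def c'_def d'_def intro!: ext sum.cong)
  let ?u = "\<lambda>\<omega>. H \<omega> - comb F c \<omega>" and ?v = "\<lambda>\<omega>. H' \<omega> - comb G d \<omega>"
  have uv: "?u \<in> L2 M" "?v \<in> L2 M" using L comb_L2 F G by (auto intro: L2_diff)
  have "(\<lambda>\<omega>. (a * H \<omega> + b * H' \<omega>) - comb (F \<union> G) (\<lambda>x. a * c' x + b * d' x) \<omega>)
      = (\<lambda>\<omega>. a * ?u \<omega> + b * ?v \<omega>)"
    using comb_lincomb[OF F(1) G(1), of c' d' a b] cd
    by (auto simp: c'_def d'_def algebra_simps fun_eq_iff)
  then have "ip M (\<lambda>\<omega>. (a * H \<omega> + b * H' \<omega>) - comb (F \<union> G) (\<lambda>x. a * c' x + b * d' x) \<omega>)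
      (\<lambda>\<omega>. (a * H \<omega> + b * H' \<omega>) - comb (F \<union> G) (\<lambda>x. a * c' x + b * d' x) \<omega>)
    = a\<^sup>2 * ip M ?u ?u + 2 * a * b * ip M ?u ?v + b\<^sup>2 * ip M ?v ?v"
    using ip_lincomb_self[OF uv] by simp
  \<comment> \<open>The difference of the two sides is the squared norm of
    \<open>a * u - b * v\<close>.\<close>
  also have "\<dots> \<le> 2 * a\<^sup>2 * ip M ?u ?u + 2 * b\<^sup>2 * ip M ?v ?v"
    using ip_self_nonneg[of M "\<lambda>\<omega>. a * ?u \<omega> + (- b) * ?v \<omega>"] ip_lincomb_self[OF uv, of a "- b"] by simp
  also have "\<dots> \<le> (2 * a\<^sup>2 + 2 * b\<^sup>2) * \<delta>"
    unfolding distrib_right using F(3) G(3) by (intro add_mono mult_left_mono) auto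
  also have "\<dots> < e"
    using e pos \<delta> by (simp add: \<delta>_def field_simps)
  finally show "\<exists>F c. finite F \<and> F \<subseteq> T \<and> ip M (\<lambda>\<omega>. (a * H \<omega> + b * H' \<omega>) - comb F c \<omega>)
      (\<lambda>\<omega>. (a * H \<omega> + b * H' \<omega>) - comb F c \<omega>) < e"
    using F(1,2) G(1,2) by (intro exI[of _ "F \<union> G"] exI[of _ "\<lambda>x. a * c' x + b * d' x"]) auto
qed

section \<open>Continuity and positivity of the covariance kernel; weak duality\<close>

lemma continuous_on_R: "continuous_on (T \<times> T) (\<lambda>(s, t). R s t)"
  unfolding continuous_on_sequentially
proof (intro allI ballI impI, elim conjE)
  fix u z assume z: "z \<in> T \<times> T" and u: "\<forall>n. u n \<in> T \<times> T" and lim: "u \<longlonglongrightarrow> z"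
  have T: "fst (u n) \<in> T" "snd (u n) \<in> T" "fst z \<in> T" "snd z \<in> T" for n
    using u z by (auto simp: mem_Times_iff)
  have "(\<lambda>n. ip M (X (fst (u n))) (X (snd (u n)))) \<longlonglongrightarrow> ip M (X (fst z)) (X (snd z))"
    by (intro L2_tendsto_ip X_L2 X_tendsto T tendsto_intros lim)
  then show "((\<lambda>(s, t). R s t) \<circ> u) \<longlonglongrightarrow> (case z of (s, t) \<Rightarrow> R s t)"
    by (simp add: comp_def case_prod_beta R_eq T)
qed

lemma continuous_on_R_subset: "A \<subseteq> T \<Longrightarrow> B \<subseteq> T \<Longrightarrow> continuous_on (A \<times> B) (\<lambda>(s, t). R s t)"
  using continuous_on_R by (rule continuous_on_subset) auto

lemma continuous_on_ip: "H \<in> L2 M \<Longrightarrow> continuous_on T (\<lambda>t. ip M (X t) H)"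
  unfolding continuous_on_sequentially comp_def
  by (intro allI ballI impI, elim conjE, intro L2_tendsto_ip X_L2 X_tendsto L2_tendsto_const) auto

lemma psd_R: "psd_kernel T R"
  unfolding psd_kernel_def
proof (intro conjI ballI allI impI)
  show "R s t = R t s" if "s \<in> T" "t \<in> T" for s t
    using that by (simp add: R_eq ip_commute)
  show "0 \<le> (\<Sum>s\<in>F. \<Sum>t\<in>F. c s * c t * R s t)" if "finite F" "F \<subseteq> T" for F c
    using ip_comb_comb[OF that(2), of c] ip_self_nonneg[of M "comb F c"] by simp
qed

text \<open>On the combination \<open>u\<close> with coefficients \<open>c\<close> the form is
  \<open>ip M H H * ip M u u - (ip M u H)\<^sup>2\<close>, so positivity is Cauchy-Schwarz; as a
  kernel statement it extends to measures.\<close>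

lemma psd_ip_defect:
  assumes "H \<in> L2 M"
  shows "psd_kernel T (\<lambda>s t. ip M H H * R s t - ip M (X s) H * ip M (X t) H)"
  unfolding psd_kernel_def
proof (intro conjI ballI allI impI)
  fix F and c :: "'t \<Rightarrow> real" assume F: "finite F" "F \<subseteq> T"
  let ?h = "\<lambda>s. ip M (X s) H"
  have "(\<Sum>s\<in>F. \<Sum>t\<in>F. c s * c t * (ip M H H * R s t - ?h s * ?h t))
      = (\<Sum>s\<in>F. \<Sum>t\<in>F. ip M H H * (c s * c t * R s t) - (c s * ?h s) * (c t * ?h t))"
    by (intro sum.cong refl) (simp add: algebra_simps)
  also have "\<dots> = ip M H H * (\<Sum>s\<in>F. \<Sum>t\<in>F. c s * c t * R s t) - (\<Sum>s\<in>F. c s * ?h s) * (\<Sum>t\<in>F. c t * ?h t)"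
    by (simp only: sum_subtractf sum_product) (simp only: sum_distrib_left)
  also have "\<dots> = ip M H H * ip M (comb F c) (comb F c) - (ip M (comb F c) H)\<^sup>2"
    by (simp only: ip_comb_comb[OF F(2)] ip_comb_left[OF F(2) assms] power2_eq_square)
  also have "\<dots> \<ge> 0"
    using ip_Cauchy_Schwarz[OF comb_L2[OF F(2)] assms, of c] by (simp add: mult.commute)
  finally show "0 \<le> (\<Sum>s\<in>F. \<Sum>t\<in>F. c s * c t * (ip M H H * R s t - ?h s * ?h t))" .
qed (use psd_R in \<open>auto simp: psd_kernel_def\<close>)

lemma dbl_int_defect:
  assumes K: "compact K" "K \<subseteq> T" "compact L" "L \<subseteq> T" and \<mu>: "\<mu> \<in> borel_probs K" and \<nu>: "\<nu> \<in> borel_probs L"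
    and H: "H \<in> L2 M"
  shows "dbl_int (\<lambda>s t. N * R s t - ip M (X s) H * ip M (X t) H) \<mu> \<nu>
    = N * dbl_int R \<mu> \<nu> - (\<integral>s. ip M (X s) H \<partial>\<mu>) * (\<integral>t. ip M (X t) H \<partial>\<nu>)"
proof -
  let ?h = "\<lambda>s. ip M (X s) H"
  have h: "continuous_on K ?h" "continuous_on L ?h"
    using continuous_on_ip[OF H] K by (auto intro: continuous_on_subset)
  have "dbl_int (\<lambda>s t. N * R s t - ?h s * ?h t) \<mu> \<nu> = (\<integral>s. N * (\<integral>t. R s t \<partial>\<nu>) - ?h s * (\<integral>t. ?h t \<partial>\<nu>) \<partial>\<mu>)"
    unfolding dbl_int_def
  proof (rule Bochner_Integration.integral_cong[OF refl])
    fix s assume "s \<in> space \<mu>"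
    then have "s \<in> K" using borel_probsD(3)[OF \<mu>] by simp
    then have "integrable \<nu> (\<lambda>t. R s t)" "integrable \<nu> ?h"
      using K h continuous_on_section[OF continuous_on_R_subset[OF K(2,4)]]
      by (auto intro!: borel_probs_integrable[OF \<nu>])
    then show "(\<integral>t. N * R s t - ?h s * ?h t \<partial>\<nu>) = N * (\<integral>t. R s t \<partial>\<nu>) - ?h s * (\<integral>t. ?h t \<partial>\<nu>)"
      by simp
  qed
  also have "\<dots> = N * dbl_int R \<mu> \<nu> - (\<integral>s. ?h s \<partial>\<mu>) * (\<integral>t. ?h t \<partial>\<nu>)"
  proof -
    have "integrable \<mu> (\<lambda>s. \<integral>t. R s t \<partial>\<nu>)" "integrable \<mu> ?h"
      using K h continuous_on_integral_section[OF K(1,3) continuous_on_R_subset[OF K(2,4)] \<nu>]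
      by (auto intro!: borel_probs_integrable[OF \<mu>])
    then show ?thesis by (simp add: dbl_int_def)
  qed
  finally show ?thesis .
qed

text \<open>Positivity of the kernel \<open>?Q\<close> on the signed measure
  \<open>(1 + q * r) \<mu> - q \<nu>\<close> takes the place of Cauchy-Schwarz for its
  integral.\<close>

lemma weak_duality:
  assumes H: "H \<in> feasible M T X K1 K2 r" and \<mu>: "\<mu> \<in> borel_probs K1" and \<nu>: "\<nu> \<in> borel_probs K2"
    and q: "0 \<le> q"
  shows "1 \<le> ip M H H * (dbl_int R \<mu> \<mu> + 2 * q * (r * dbl_int R \<mu> \<mu> - dbl_int R \<mu> \<nu>) + q\<^sup>2 * B_term R \<mu> \<nu> r)"
proof -
  let ?h = "\<lambda>s. ip M (X s) H" and ?N = "ip M H H"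
  let ?Q = "\<lambda>s t. ?N * R s t - ?h s * ?h t"
  have HL: "H \<in> L2 M" and h1: "\<And>t. t \<in> K1 \<Longrightarrow> 1 \<le> ?h t" and h2: "\<And>t. t \<in> K2 \<Longrightarrow> ?h t \<le> r"
    using H ms_closure_L2 by (auto simp: feasible_def ip_def)
  have cont: "continuous_on K1 ?h" "continuous_on K2 ?h"
    using continuous_on_ip[OF HL] K1 K2 by (auto intro: continuous_on_subset)
  interpret m: prob_space \<mu> using borel_probsD[OF \<mu>] by simp
  interpret n: prob_space \<nu> using borel_probsD[OF \<nu>] by simp
  have "(\<integral>s. 1 \<partial>\<mu>) \<le> (\<integral>s. ?h s \<partial>\<mu>)"
    using h1 borel_probsD(3)[OF \<mu>] borel_probs_integrable[OF \<mu> K1(1) cont(1)] by (intro integral_mono) auto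
  then have I1: "1 \<le> (\<integral>s. ?h s \<partial>\<mu>)" by (simp add: m.prob_space)
  have "(\<integral>s. ?h s \<partial>\<nu>) \<le> (\<integral>s. r \<partial>\<nu>)"
    using h2 borel_probsD(3)[OF \<nu>] borel_probs_integrable[OF \<nu> K2(1) cont(2)] by (intro integral_mono) auto
  then have I2: "(\<integral>s. ?h s \<partial>\<nu>) \<le> r" by (simp add: n.prob_space)
  have cQ: "continuous_on (T \<times> T) (\<lambda>(s, t). ?Q s t)"
  proof -
    have "continuous_on (T \<times> T) (\<lambda>z. ?h (fst z))" "continuous_on (T \<times> T) (\<lambda>z. ?h (snd z))"
      by (auto intro!: continuous_on_compose2[OF continuous_on_ip[OF HL]] continuous_intros)
    moreover have "continuous_on (T \<times> T) (\<lambda>z. R (fst z) (snd z))"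
      using continuous_on_R by (simp add: case_prod_beta)
    ultimately show ?thesis unfolding case_prod_beta by (intro continuous_intros)
  qed
  define x y where "x = (\<integral>s. ?h s \<partial>\<mu>)" and "y = (\<integral>s. ?h s \<partial>\<nu>)"
  have "0 \<le> (1 + q * r)\<^sup>2 * dbl_int ?Q \<mu> \<mu> - 2 * (1 + q * r) * q * dbl_int ?Q \<mu> \<nu> + q\<^sup>2 * dbl_int ?Q \<nu> \<nu>"
    by (rule psd_kernel_dbl_int[OF psd_ip_defect[OF HL] cQ K1(1) K2(1) K1(3) K2(3) \<mu> \<nu>])
  also have "\<dots> = (1 + q * r)\<^sup>2 * (?N * dbl_int R \<mu> \<mu> - x * x)
      - 2 * (1 + q * r) * q * (?N * dbl_int R \<mu> \<nu> - x * y) + q\<^sup>2 * (?N * dbl_int R \<nu> \<nu> - y * y)"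
    unfolding x_def y_def dbl_int_defect[OF K1(1,3) K1(1,3) \<mu> \<mu> HL] dbl_int_defect[OF K1(1,3) K2(1,3) \<mu> \<nu> HL]
      dbl_int_defect[OF K2(1,3) K2(1,3) \<nu> \<nu> HL] ..
  \<comment> \<open>\<open>B_term\<close> regroups the variance by powers of \<open>q\<close>; the
    rank-one part of the kernel contributes the square of the pairing with \<open>H\<close>.\<close>
  also have "\<dots> = ?N * (dbl_int R \<mu> \<mu> + 2 * q * (r * dbl_int R \<mu> \<mu> - dbl_int R \<mu> \<nu>) + q\<^sup>2 * B_term R \<mu> \<nu> r)
      - ((1 + q * r) * x - q * y)\<^sup>2"
    by (simp add: B_term_def power2_eq_square algebra_simps)
  finally have "((1 + q * r) * x - q * y)\<^sup>2
      \<le> ?N * (dbl_int R \<mu> \<mu> + 2 * q * (r * dbl_int R \<mu> \<mu> - dbl_int R \<mu> \<nu>) + q\<^sup>2 * B_term R \<mu> \<nu> r)" by simp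
  moreover have "1 \<le> (1 + q * r) * x - q * y"
  proof -
    have "(1 + q * r) * 1 \<le> (1 + q * r) * x" "q * y \<le> q * r"
      unfolding x_def y_def by (rule mult_left_mono[OF I1], use q r_pos in simp, rule mult_left_mono[OF I2 q])
    then show ?thesis by simp
  qed
  then have "1 \<le> ((1 + q * r) * x - q * y)\<^sup>2" by (rule one_le_power)
  ultimately show ?thesis by linarith
qed

lemma R_quadratic_nonneg:
  assumes \<mu>: "\<mu> \<in> borel_probs K1" and \<nu>: "\<nu> \<in> borel_probs K2"
  shows "0 \<le> p\<^sup>2 * dbl_int R \<mu> \<mu> - 2 * p * q * dbl_int R \<mu> \<nu> + q\<^sup>2 * dbl_int R \<nu> \<nu>"
  by (rule psd_kernel_dbl_int[OF psd_R continuous_on_R K1(1) K2(1) K1(3) K2(3) \<mu> \<nu>])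

lemma A_term_nonneg:
  assumes "\<mu> \<in> borel_probs K1" "\<nu> \<in> borel_probs K2"
  shows "0 \<le> A_term R \<mu> \<nu>"
proof -
  have "(- dbl_int R \<mu> \<nu>)\<^sup>2 \<le> dbl_int R \<mu> \<mu> * dbl_int R \<nu> \<nu>"
    using R_quadratic_nonneg[OF assms, of 1] R_quadratic_nonneg[OF assms, of 0 1]
    by (intro discriminant_le_zero) (auto simp: algebra_simps)
  then show ?thesis by (simp add: A_term_def)
qed

lemma B_term_nonneg:
  assumes "\<mu> \<in> borel_probs K1" "\<nu> \<in> borel_probs K2"
  shows "0 \<le> B_term R \<mu> \<nu> r"
  using R_quadratic_nonneg[OF assms, of r 1] by (simp add: B_term_def algebra_simps)

text \<open>The variance is a parabola in \<open>q\<close>; admissibility of the pair says exactly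
  that its vertex is nonnegative when B is positive, which ties the quotient A / B to admissible
  pairs.\<close>

lemma completed_square:
  assumes "B_term R \<mu> \<nu> r \<noteq> 0"
  shows "dbl_int R \<mu> \<mu> + 2 * q * (r * dbl_int R \<mu> \<mu> - dbl_int R \<mu> \<nu>) + q\<^sup>2 * B_term R \<mu> \<nu> r
    = A_term R \<mu> \<nu> / B_term R \<mu> \<nu> r
      + B_term R \<mu> \<nu> r * (q - (dbl_int R \<mu> \<nu> - r * dbl_int R \<mu> \<mu>) / B_term R \<mu> \<nu> r)\<^sup>2"
proof -
  define a b c B where "a = dbl_int R \<mu> \<mu>" and "b = dbl_int R \<mu> \<nu>" and "c = dbl_int R \<nu> \<nu>"
    and "B = B_term R \<mu> \<nu> r"
  have B: "B \<noteq> 0" using assms by (simp add: B_def)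
  have c: "c = B - r\<^sup>2 * a + 2 * r * b"
    by (simp add: B_def B_term_def a_def b_def c_def)
  \<comment> \<open>Gram determinant: it is unchanged when the second vector is replaced by
    \<open>r\<close> times the first minus the second, whose squared norm is
    \<open>B\<close>.\<close>
  have "a * c - b\<^sup>2 = a * B - (b - r * a)\<^sup>2"
    unfolding c by (simp add: power2_eq_square algebra_simps)
  then have "(a * c - b\<^sup>2) / B = a - (b - r * a)\<^sup>2 / B"
    using B by (simp add: diff_divide_distrib)
  moreover have "B * (q - d / B)\<^sup>2 = q\<^sup>2 * B - 2 * q * d + d\<^sup>2 / B"
    for d
    using B by (simp add: field_simps power2_eq_square)
  ultimately have "a + 2 * q * (r * a - b) + q\<^sup>2 * B = (a * c - b\<^sup>2) / B + B * (q - (b - r * a) / B)\<^sup>2"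
    by (simp add: right_diff_distrib mult.assoc)
  then show ?thesis by (simp only: A_term_def a_def b_def c_def B_def)
qed

section \<open>The dual convex set and strong duality\<close>

lemma feasible_ip:
  "H \<in> feasible M T X K1 K2 r \<longleftrightarrow> H \<in> ms_closure M T X \<and>
     (\<forall>t\<in>K1. 1 \<le> ip M (X t) H) \<and> (\<forall>t\<in>K2. ip M (X t) H \<le> r)"
  by (simp add: feasible_def ip_def)

text \<open>
  The weak duality bound for the signed measure \<open>(1 + q r) \<mu>\<^sub>1 - q \<mu>\<^sub>2\<close> is a lower bound for the
  variance of the integral of \<open>X\<close> against it; \<open>dual_combs\<close> are these integrals for finitely
  supported measures.
\<close>

definition dual_coeffs :: "'t set \<Rightarrow> ('t \<Rightarrow> real) \<Rightarrow> ('t \<Rightarrow> real) \<Rightarrow> bool" where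
  "dual_coeffs F \<alpha> \<beta> \<longleftrightarrow> finite F \<and> F \<subseteq> T \<and> (\<forall>x. 0 \<le> \<alpha> x \<and> 0 \<le> \<beta> x) \<and>
     (\<forall>x. x \<notin> F \<inter> K1 \<longrightarrow> \<alpha> x = 0) \<and> (\<forall>x. x \<notin> F \<inter> K2 \<longrightarrow> \<beta> x = 0) \<and> sum \<alpha> F = 1 + r * sum \<beta> F"

definition dual_combs :: "('a \<Rightarrow> real) set" where
  "dual_combs = {comb F (\<lambda>x. \<alpha> x - \<beta> x) | F \<alpha> \<beta>. dual_coeffs F \<alpha> \<beta>}"

lemma dual_combsI: "dual_coeffs F \<alpha> \<beta> \<Longrightarrow> comb F (\<lambda>x. \<alpha> x - \<beta> x) \<in> dual_combs"
  by (auto simp: dual_combs_def)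

lemma dual_combs_L2: "dual_combs \<subseteq> L2 M"
  by (auto simp: dual_combs_def dual_coeffs_def intro!: comb_L2)

text \<open>The side condition on the sums is affine in the pair of weights. The two weights are
  mixed separately: where \<open>K1\<close> and \<open>K2\<close> overlap, their difference does not
  determine them.\<close>

lemma dual_combs_convex:
  assumes u: "u \<in> dual_combs" and v: "v \<in> dual_combs" and l: "0 \<le> l" "l \<le> 1"
  shows "(\<lambda>\<omega>. (1 - l) * u \<omega> + l * v \<omega>) \<in> dual_combs"
proof -
  obtain F \<alpha> \<beta> where F: "dual_coeffs F \<alpha> \<beta>" and u: "u = comb F (\<lambda>x. \<alpha> x - \<beta> x)"
    using u by (auto simp: dual_combs_def)
  obtain G \<gamma> \<delta> where G: "dual_coeffs G \<gamma> \<delta>" and v: "v = comb G (\<lambda>x. \<gamma> x - \<delta> x)"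
    using v by (auto simp: dual_combs_def)
  note D = F[unfolded dual_coeffs_def] G[unfolded dual_coeffs_def]
  let ?\<alpha> = "\<lambda>x. (1 - l) * \<alpha> x + l * \<gamma> x" and ?\<beta> = "\<lambda>x. (1 - l) * \<beta> x + l * \<delta> x"
  have "(\<lambda>\<omega>. (1 - l) * u \<omega> + l * v \<omega>) = comb (F \<union> G) (\<lambda>x. (1 - l) * (\<alpha> x - \<beta> x) + l * (\<gamma> x - \<delta> x))"
    unfolding u v using D by (intro comb_lincomb) auto
  also have "\<dots> = comb (F \<union> G) (\<lambda>x. ?\<alpha> x - ?\<beta> x)"
    by (simp add: algebra_simps)
  finally have eq: "(\<lambda>\<omega>. (1 - l) * u \<omega> + l * v \<omega>) = comb (F \<union> G) (\<lambda>x. ?\<alpha> x - ?\<beta> x)" .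
  have fin: "finite (F \<union> G)" using D by simp
  have ext: "sum \<alpha> F = sum \<alpha> (F \<union> G)" "sum \<beta> F = sum \<beta> (F \<union> G)"
      "sum \<gamma> G = sum \<gamma> (F \<union> G)" "sum \<delta> G = sum \<delta> (F \<union> G)"
    by (intro sum.mono_neutral_left; use D in auto)+
  have "sum ?\<alpha> (F \<union> G) = (1 - l) * sum \<alpha> F + l * sum \<gamma> G"
    unfolding ext by (simp add: sum.distrib sum_distrib_left)
  also have "\<dots> = 1 + r * ((1 - l) * sum \<beta> F + l * sum \<delta> G)"
    using D by (simp add: algebra_simps)
  also have "(1 - l) * sum \<beta> F + l * sum \<delta> G = sum ?\<beta> (F \<union> G)"
    unfolding ext by (simp add: sum.distrib sum_distrib_left)
  finally have s: "sum ?\<alpha> (F \<union> G) = 1 + r * sum ?\<beta> (F \<union> G)" .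
  have pos: "\<forall>x. 0 \<le> ?\<alpha> x \<and> 0 \<le> ?\<beta> x" using D l by simp
  have "dual_coeffs (F \<union> G) ?\<alpha> ?\<beta>"
    unfolding dual_coeffs_def using D fin s pos by auto
  from dual_combsI[OF this] show ?thesis unfolding eq .
qed

text \<open>Elements built from one point mass on each side; the variational inequality on these
  alone yields pointwise constraints on \<open>K1\<close> and \<open>K2\<close>.\<close>

lemma dual_combs_generator:
  assumes s: "s \<in> K1" and t: "t \<in> K2" and q: "0 \<le> q" and H: "H \<in> L2 M"
  obtains u where "u \<in> dual_combs" "ip M u H = ip M (X s) H + q * (r * ip M (X s) H - ip M (X t) H)"
proof -
  define \<alpha> where "\<alpha> x = (if x = s then 1 + q * r else 0)" for x
  define \<beta> where "\<beta> x = (if x = t then q else 0)" for x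
  have T: "{s, t} \<subseteq> T" using s t K1 K2 by auto
  have "dual_coeffs {s, t} \<alpha> \<beta>"
    using s t q r_pos T by (auto simp: dual_coeffs_def \<alpha>_def \<beta>_def)
  then have "comb {s, t} (\<lambda>x. \<alpha> x - \<beta> x) \<in> dual_combs" by (rule dual_combsI)
  moreover have "ip M (comb {s, t} (\<lambda>x. \<alpha> x - \<beta> x)) H = ip M (X s) H + q * (r * ip M (X s) H - ip M (X t) H)"
    unfolding ip_comb_left[OF T H] by (cases "s = t") (auto simp: \<alpha>_def \<beta>_def algebra_simps)
  ultimately show ?thesis by (rule that)
qed

text \<open>Normalizing the weights to probability measures turns the squared norm into the
  quadratic in \<open>q\<close>, with \<open>q\<close> the total mass of \<open>\<beta>\<close>.
  This links the Hilbert-space minimum to the two minimization problems.\<close>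

lemma dual_combs_norm:
  assumes u: "u \<in> dual_combs"
  obtains \<mu> \<nu> q where "\<mu> \<in> borel_probs K1" "\<nu> \<in> borel_probs K2" "0 \<le> q"
    "ip M u u = dbl_int R \<mu> \<mu> + 2 * q * (r * dbl_int R \<mu> \<mu> - dbl_int R \<mu> \<nu>) + q\<^sup>2 * B_term R \<mu> \<nu> r"
proof -
  obtain F \<alpha> \<beta> where F: "dual_coeffs F \<alpha> \<beta>" and u: "u = comb F (\<lambda>x. \<alpha> x - \<beta> x)"
    using u by (auto simp: dual_combs_def)
  note D = F[unfolded dual_coeffs_def]
  obtain k where k: "k \<in> K2" using K2 by auto
  define q p where "q = sum \<beta> F" and "p = 1 + r * q"
  have q: "0 \<le> q" unfolding q_def using D by (intro sum_nonneg) auto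
  have p: "1 \<le> p" using q r_pos by (simp add: p_def)
  \<comment> \<open>\<open>k\<close> is added for the case \<open>q = 0\<close>: there
    \<open>\<beta>\<close> is zero and cannot be normalized, any probability measure on
    \<open>K2\<close> will do, and the point mass at \<open>k\<close> is taken.\<close>
  define U where "U = insert k F"
  have U: "finite U" "F \<inter> K1 \<subseteq> U" "F \<inter> K2 \<subseteq> U" "{k} \<subseteq> U" "U \<subseteq> T"
    using D k K2 by (auto simp: U_def)
  have sum1: "sum \<alpha> (F \<inter> K1) = p"
    using D by (subst sum.mono_neutral_left[of F]) (auto simp: p_def q_def)
  have sum2: "sum \<beta> (F \<inter> K2) = q"
    using D by (subst sum.mono_neutral_left[of F]) (auto simp: q_def)
  define w where "w x = \<alpha> x / p" for x
  obtain \<mu> where \<mu>: "discrete_on K1 \<mu> (F \<inter> K1) w"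
  proof (rule discrete_on_exists[of "F \<inter> K1" K1 w])
    show "sum w (F \<inter> K1) = 1"
      using sum1 p by (simp add: w_def sum_divide_distrib[symmetric])
  qed (use D p in \<open>auto simp: w_def\<close>)
  have "\<exists>\<nu> G v. discrete_on K2 \<nu> G v \<and> G \<subseteq> U \<and> (\<forall>x. \<beta> x = q * v x)"
  proof (cases "q = 0")
    case True
    have "\<beta> x = 0" for x
      using True D sum_nonneg_eq_0_iff[of F \<beta>] by (cases "x \<in> F") (auto simp: q_def)
    moreover obtain \<nu> where "discrete_on K2 \<nu> {k} (\<lambda>x. if x = k then 1 else 0)"
      using k by (rule_tac discrete_on_exists[of "{k}" K2 "\<lambda>x. if x = k then 1 else 0"]) auto
    ultimately show ?thesis using U True by auto
  next
    case False
    define v where "v x = \<beta> x / q" for x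
    obtain \<nu> where "discrete_on K2 \<nu> (F \<inter> K2) v"
    proof (rule discrete_on_exists[of "F \<inter> K2" K2 v])
      show "sum v (F \<inter> K2) = 1"
        using sum2 False by (simp add: v_def sum_divide_distrib[symmetric])
    qed (use D q in \<open>auto simp: v_def\<close>)
    moreover have "\<beta> x = q * v x" for x using False by (simp add: v_def)
    ultimately show ?thesis using U by blast
  qed
  then obtain \<nu> G v where \<nu>: "discrete_on K2 \<nu> G v" "G \<subseteq> U" and \<beta>: "\<And>x. \<beta> x = q * v x"
    by blast
  have \<alpha>: "\<alpha> x = p * w x" for x using p by (simp add: w_def)
  have "u = comb U (\<lambda>x. p * w x - q * v x)"
    unfolding u \<alpha>[symmetric] \<beta>[symmetric] using D U by (intro comb_superset) (auto simp: U_def)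
  then have "ip M u u = (\<Sum>s\<in>U. \<Sum>t\<in>U. (p * w s - q * v s) * (p * w t - q * v t) * R s t)"
    using ip_comb_comb[OF U(5)] by simp
  also have "\<dots> = p\<^sup>2 * (\<Sum>s\<in>U. \<Sum>t\<in>U. w s * w t * R s t) - 2 * p * q * (\<Sum>s\<in>U. \<Sum>t\<in>U. w s * v t * R s t)
      + q\<^sup>2 * (\<Sum>s\<in>U. \<Sum>t\<in>U. v s * v t * R s t)"
    by (rule quadratic_form_diff) (use psd_R U(5) in \<open>unfold psd_kernel_def, blast\<close>)
  also have "\<dots> = p\<^sup>2 * dbl_int R \<mu> \<mu> - 2 * p * q * dbl_int R \<mu> \<nu> + q\<^sup>2 * dbl_int R \<nu> \<nu>"
    unfolding dbl_int_discrete[OF \<mu> \<mu> continuous_on_R_subset[OF K1(3) K1(3)] U(1,2,2)]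
      dbl_int_discrete[OF \<mu> \<nu>(1) continuous_on_R_subset[OF K1(3) K2(3)] U(1,2) \<nu>(2)]
      dbl_int_discrete[OF \<nu>(1) \<nu>(1) continuous_on_R_subset[OF K2(3) K2(3)] U(1) \<nu>(2) \<nu>(2)] ..
  also have "\<dots> = dbl_int R \<mu> \<mu> + 2 * q * (r * dbl_int R \<mu> \<mu> - dbl_int R \<mu> \<nu>) + q\<^sup>2 * B_term R \<mu> \<nu> r"
    by (simp add: p_def B_term_def power2_eq_square algebra_simps)
  finally show ?thesis
    using that[OF _ _ q] \<mu> \<nu> by (auto simp: discrete_on_def)
qed

lemma dual_lower_bound:
  assumes m1: "\<And>\<mu>. \<mu> \<in> borel_probs K1 \<Longrightarrow> m \<le> dbl_int R \<mu> \<mu>"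
    and m2: "\<And>\<mu> \<nu>. (\<mu>, \<nu>) \<in> nondegenerate_pairs R K1 K2 r \<Longrightarrow> m \<le> A_term R \<mu> \<nu> / B_term R \<mu> \<nu> r"
    and mem: "\<mu> \<in> borel_probs K1" "\<nu> \<in> borel_probs K2" and q: "0 \<le> q"
  shows "m \<le> dbl_int R \<mu> \<mu> + 2 * q * (r * dbl_int R \<mu> \<mu> - dbl_int R \<mu> \<nu>) + q\<^sup>2 * B_term R \<mu> \<nu> r"
proof (cases "dbl_int R \<mu> \<nu> \<le> r * dbl_int R \<mu> \<mu>")
  case True
  then have "0 \<le> 2 * q * (r * dbl_int R \<mu> \<mu> - dbl_int R \<mu> \<nu>)" using q by simp
  moreover have "0 \<le> q\<^sup>2 * B_term R \<mu> \<nu> r" using B_term_nonneg[OF mem] by simp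
  ultimately show ?thesis using m1[OF mem(1)] by linarith
next
  case False
  \<comment> \<open>Cauchy-Schwarz for the first integral and \<open>r\<close> times the first minus
    the second: B = 0 would force \<open>dbl_int R \<mu> \<nu> = r * dbl_int R \<mu> \<mu>\<close>,
    which this case excludes. So the pair is nondegenerate and \<open>m2\<close> applies.\<close>
  have "(r * dbl_int R \<mu> \<mu> - dbl_int R \<mu> \<nu>)\<^sup>2 \<le> dbl_int R \<mu> \<mu> * B_term R \<mu> \<nu> r"
  proof (rule discriminant_le_zero)
    fix x
    show "0 \<le> dbl_int R \<mu> \<mu> + 2 * (r * dbl_int R \<mu> \<mu> - dbl_int R \<mu> \<nu>) * x + B_term R \<mu> \<nu> r * x\<^sup>2"
      using R_quadratic_nonneg[OF mem, of "1 + x * r" x] by (simp add: B_term_def power2_eq_square algebra_simps)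
  qed (rule B_term_nonneg[OF mem])
  then have B: "B_term R \<mu> \<nu> r \<noteq> 0" using False by auto
  then have "m \<le> A_term R \<mu> \<nu> / B_term R \<mu> \<nu> r"
    using False mem by (intro m2) (auto simp: nondegenerate_pairs_def admissible_pairs_def)
  moreover have "0 \<le> B_term R \<mu> \<nu> r * (q - (dbl_int R \<mu> \<nu> - r * dbl_int R \<mu> \<mu>) / B_term R \<mu> \<nu> r)\<^sup>2"
    using B_term_nonneg[OF mem] by simp
  ultimately show ?thesis unfolding completed_square[OF B] by linarith
qed

lemma strong_duality:
  assumes m: "0 < m" and m1: "\<And>\<mu>. \<mu> \<in> borel_probs K1 \<Longrightarrow> m \<le> dbl_int R \<mu> \<mu>"
    and m2: "\<And>\<mu> \<nu>. (\<mu>, \<nu>) \<in> nondegenerate_pairs R K1 K2 r \<Longrightarrow> m \<le> A_term R \<mu> \<nu> / B_term R \<mu> \<nu> r"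
  obtains H where "H \<in> feasible M T X K1 K2 r" "ip M H H \<le> 1 / m"
proof -
  obtain s0 t0 where st: "s0 \<in> K1" "t0 \<in> K2" using K1 K2 by auto
  have ne: "dual_combs \<noteq> {}"
    by (rule dual_combs_generator[OF st order_refl L2_zero]) auto
  obtain V v where
    V: "V \<in> L2 M" and v: "\<And>n::nat. v n \<in> dual_combs" and lim: "L2_tendsto M v V"
    and var: "\<And>u. u \<in> dual_combs \<Longrightarrow> ip M V V \<le> ip M u V"
    by (rule L2_nearest_point[OF dual_combs_L2 ne dual_combs_convex]) blast+
  define m0 where "m0 = ip M V V"
  define h where "h t = ip M (X t) V" for t
  have vL: "v n \<in> L2 M" for n using v dual_combs_L2 by auto
  \<comment> \<open>The bounds are applied to finitely supported measures and pass to
    \<open>V\<close> in the limit; with \<open>0 < m\<close> they keep \<open>V\<close> away from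
    zero.\<close>
  have "m \<le> ip M u u" if "u \<in> dual_combs" for u
    using dual_combs_norm[OF that] dual_lower_bound[OF m1 m2] by metis
  moreover have "(\<lambda>n. ip M (v n) (v n)) \<longlonglongrightarrow> m0"
    unfolding m0_def by (rule L2_tendsto_ip[OF vL vL V V lim lim])
  ultimately have mm0: "m \<le> m0"
    using v by (intro LIMSEQ_le_const) auto
  have gen: "m0 \<le> h s + q * (r * h s - h t)" if "s \<in> K1" "t \<in> K2" "0 \<le> q" for s t q
    using dual_combs_generator[OF that V] var unfolding m0_def h_def by metis
  have h1: "m0 \<le> h s" if "s \<in> K1" for s using gen[OF that st(2), of 0] by simp
  have hr: "h t \<le> r * h s" if "s \<in> K1" "t \<in> K2" for s t
  proof (rule ccontr)
    assume "\<not> h t \<le> r * h s"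
    then have neg: "r * h s - h t < 0" by simp
    \<comment> \<open>Pushes the right-hand side of \<open>gen\<close> down to
      \<open>m0 - 1\<close>.\<close>
    define q where "q = (h s - m0 + 1) / (h t - r * h s)"
    have "0 \<le> q" using neg h1[OF that(1)] by (simp add: q_def)
    moreover have "q * (r * h s - h t) = - (h s - m0 + 1)"
      using neg by (simp add: q_def field_simps)
    ultimately show False using gen[OF that, of q] by simp
  qed
  have h2: "h t \<le> r * m0" if t: "t \<in> K2" for t
  proof -
    \<comment> \<open>Large \<open>q\<close> gave only \<open>h t \<le> r * h s\<close>, and
      \<open>h s\<close> may exceed \<open>m0\<close>. The best such bound is \<open>r * I\<close>;
      it remains to see that \<open>I \<le> m0\<close>, which follows from the sequence
      \<open>v\<close> approximating \<open>V\<close>.\<close>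
    define I where "I = (INF s\<in>K1. h s)"
    have bdd: "bdd_below (h ` K1)" using h1 by (auto intro!: bdd_belowI[of _ m0])
    have I_le: "I \<le> h s" if "s \<in> K1" for s unfolding I_def using bdd that by (rule cINF_lower)
    have hI: "h t' \<le> r * I" if "t' \<in> K2" for t'
    proof -
      have "h t' / r \<le> I"
        unfolding I_def using K1(2) hr[OF _ that] r_pos by (intro cINF_greatest) (auto simp: field_simps)
      then show ?thesis using r_pos by (simp add: field_simps)
    qed
    have "I \<le> ip M (v n) V" for n
    proof -
      obtain F \<alpha> \<beta> where F: "dual_coeffs F \<alpha> \<beta>" and vn: "v n = comb F (\<lambda>x. \<alpha> x - \<beta> x)"
        using v[of n] by (auto simp: dual_combs_def)
      note D = F[unfolded dual_coeffs_def]
      \<comment> \<open>By the constraint \<open>sum \<alpha> F = 1 + r * sum \<beta> F\<close> the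
        left-hand side is just \<open>I\<close>.\<close>
      have "sum \<alpha> F * I - sum \<beta> F * (r * I) = (\<Sum>x\<in>F. \<alpha> x * I - \<beta> x * (r * I))"
        by (simp add: sum_distrib_right sum_subtractf)
      also have "\<dots> \<le> (\<Sum>x\<in>F. (\<alpha> x - \<beta> x) * h x)"
      proof (rule sum_mono)
        fix x assume "x \<in> F"
        have "\<alpha> x * I \<le> \<alpha> x * h x"
          using D I_le[of x] by (cases "x \<in> K1") (auto intro: mult_left_mono)
        moreover have "\<beta> x * h x \<le> \<beta> x * (r * I)"
          using D hI[of x] by (cases "x \<in> K2") (auto intro: mult_left_mono)
        ultimately show "\<alpha> x * I - \<beta> x * (r * I) \<le> (\<alpha> x - \<beta> x) * h x"
          by (simp add: left_diff_distrib)
      qed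
      also have "\<dots> = ip M (v n) V"
        unfolding vn h_def using D V by (simp add: ip_comb_left)
      finally show ?thesis using D by (simp add: algebra_simps)
    qed
    moreover have "(\<lambda>n. ip M (v n) V) \<longlonglongrightarrow> m0"
      unfolding m0_def by (rule L2_tendsto_ip[OF vL V V V lim L2_tendsto_const])
    ultimately have "I \<le> m0" by (intro LIMSEQ_le_const) auto
    then have "r * I \<le> r * m0" using r_pos by simp
    with hI[OF t] show ?thesis by simp
  qed
  have "V \<in> ms_closure M T X"
    unfolding ms_closure_ip
  proof (intro conjI V allI impI)
    fix e :: real assume "0 < e"
    then obtain n where "norm (ip M (\<lambda>x. v n x - V x) (\<lambda>x. v n x - V x) - 0) < e"
      using LIMSEQ_D[OF lim[unfolded L2_tendsto_def]] by blast
    moreover have "ip M (\<lambda>x. v n x - V x) (\<lambda>x. v n x - V x) = ip M (\<lambda>x. V x - v n x) (\<lambda>x. V x - v n x)"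
      unfolding ip_self by (simp add: power2_commute)
    moreover obtain F c where "finite F" "F \<subseteq> T" "v n = comb F c"
      using v[of n] unfolding dual_combs_def dual_coeffs_def by blast
    ultimately show "\<exists>F c. finite F \<and> F \<subseteq> T \<and> ip M (\<lambda>\<omega>. V \<omega> - comb F c \<omega>) (\<lambda>\<omega>. V \<omega> - comb F c \<omega>) < e"
      by (intro exI[of _ F] exI[of _ c]) auto
  qed
  define H where "H \<omega> = 1 / m0 * V \<omega>" for \<omega>
  have m0: "0 < m0" using m mm0 by simp
  have "H \<in> ms_closure M T X"
    using ms_closure_lincomb[OF \<open>V \<in> ms_closure M T X\<close> \<open>V \<in> ms_closure M T X\<close>, of "1 / m0" 0] by (simp add: H_def[abs_def])
  moreover have "ip M (X t) H = h t / m0" for t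
    unfolding H_def ip_scale_right h_def by simp
  ultimately have "H \<in> feasible M T X K1 K2 r"
    using h1 h2 m0 by (auto simp: feasible_ip divide_le_eq)
  moreover have "ip M H H = 1 / m0"
    unfolding H_def ip_scale_right ip_scale_left m0_def[symmetric] using m0 by simp
  moreover have "1 / m0 \<le> 1 / m" using m mm0 by (intro divide_left_mono) auto
  ultimately show ?thesis using that by simp
qed

section \<open>Value of the problem, existence and uniqueness of the minimizer\<close>

lemma borel_probs_nonempty:
  assumes "K \<noteq> {}"
  shows "borel_probs (K :: 't set) \<noteq> {}"
proof -
  obtain k where k: "k \<in> K" using assms by auto
  show ?thesis
    using k by (rule_tac discrete_on_exists[of "{k}" K "\<lambda>x. if x = k then 1 else 0"]) (auto simp: discrete_on_def)
qed

lemma feasible_bounds: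
  assumes H: "H \<in> feasible M T X K1 K2 r"
  shows "0 < ip M H H"
    and "\<mu> \<in> borel_probs K1 \<Longrightarrow> 1 / ip M H H \<le> dbl_int R \<mu> \<mu>"
    and "(\<mu>, \<nu>) \<in> nondegenerate_pairs R K1 K2 r \<Longrightarrow> 1 / ip M H H \<le> A_term R \<mu> \<nu> / B_term R \<mu> \<nu> r"
proof -
  obtain \<nu>0 where \<nu>0: "\<nu>0 \<in> borel_probs K2" using borel_probs_nonempty[OF K2(2)] by auto
  obtain \<mu>0 where \<mu>0: "\<mu>0 \<in> borel_probs K1" using borel_probs_nonempty[OF K1(2)] by auto
  \<comment> \<open>At \<open>q = 0\<close> only the variance of the first integral remains, so any
    \<open>\<nu>0\<close> serves.\<close>
  have 1: "1 \<le> ip M H H * dbl_int R \<mu> \<mu>" if "\<mu> \<in> borel_probs K1" for \<mu>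
    using weak_duality[OF H that \<nu>0, of 0] by simp
  have "ip M H H \<noteq> 0" using 1[OF \<mu>0] by auto
  then show pos: "0 < ip M H H" using ip_self_nonneg[of M H] by simp
  show "1 / ip M H H \<le> dbl_int R \<mu> \<mu>" if "\<mu> \<in> borel_probs K1"
    using 1[OF that] pos by (simp add: field_simps)
  assume nd: "(\<mu>, \<nu>) \<in> nondegenerate_pairs R K1 K2 r"
  then have mem: "\<mu> \<in> borel_probs K1" "\<nu> \<in> borel_probs K2" and B: "B_term R \<mu> \<nu> r \<noteq> 0"
    and adm: "r * dbl_int R \<mu> \<mu> \<le> dbl_int R \<mu> \<nu>"
    by (auto simp: nondegenerate_pairs_def admissible_pairs_def)
  \<comment> \<open>At the vertex of the parabola the square drops out; admissibility makes this
    \<open>q\<close> nonnegative.\<close>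
  have "1 \<le> ip M H H * (A_term R \<mu> \<nu> / B_term R \<mu> \<nu> r)"
    using weak_duality[OF H mem, of "(dbl_int R \<mu> \<nu> - r * dbl_int R \<mu> \<mu>) / B_term R \<mu> \<nu> r"]
      adm B_term_nonneg[OF mem] unfolding completed_square[OF B] by simp
  then show "1 / ip M H H \<le> A_term R \<mu> \<nu> / B_term R \<mu> \<nu> r"
    using pos by (simp add: divide_le_eq mult.commute)
qed

text \<open>In \<open>ereal\<close> an empty infimum is infinite, so without nondegenerate pairs
  only the first problem counts.\<close>

definition dual_value :: ereal where
  "dual_value = min (INF \<mu>\<in>borel_probs K1. ereal (dbl_int R \<mu> \<mu>))
     (INF (\<mu>, \<nu>)\<in>nondegenerate_pairs R K1 K2 r. ereal (A_term R \<mu> \<nu> / B_term R \<mu> \<nu> r))"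

lemma dual_value_lower:
  "\<mu> \<in> borel_probs K1 \<Longrightarrow> dual_value \<le> ereal (dbl_int R \<mu> \<mu>)"
  "(\<mu>, \<nu>) \<in> nondegenerate_pairs R K1 K2 r \<Longrightarrow> dual_value \<le> ereal (A_term R \<mu> \<nu> / B_term R \<mu> \<nu> r)"
  unfolding dual_value_def
  by (auto intro: min.coboundedI1 INF_lower, rule min.coboundedI2, auto intro: INF_lower2)

lemma dual_value_greatest:
  assumes "\<And>\<mu>. \<mu> \<in> borel_probs K1 \<Longrightarrow> m \<le> dbl_int R \<mu> \<mu>"
    "\<And>\<mu> \<nu>. (\<mu>, \<nu>) \<in> nondegenerate_pairs R K1 K2 r \<Longrightarrow> m \<le> A_term R \<mu> \<nu> / B_term R \<mu> \<nu> r"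
  shows "ereal m \<le> dual_value"
  unfolding dual_value_def using assms by (auto intro!: INF_greatest)

lemma dual_value_real:
  obtains m where "dual_value = ereal m" "0 \<le> m"
proof -
  have "ereal 0 \<le> dual_value"
  proof (rule dual_value_greatest)
    obtain \<nu> where "\<nu> \<in> borel_probs K2" using borel_probs_nonempty[OF K2(2)] by auto
    then show "0 \<le> dbl_int R \<mu> \<mu>" if "\<mu> \<in> borel_probs K1" for \<mu>
      using R_quadratic_nonneg[OF that, of \<nu> 1 0] by simp
    show "0 \<le> A_term R \<mu> \<nu> / B_term R \<mu> \<nu> r" if "(\<mu>, \<nu>) \<in> nondegenerate_pairs R K1 K2 r" for \<mu> \<nu>
      using that A_term_nonneg B_term_nonneg by (auto simp: nondegenerate_pairs_def admissible_pairs_def)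
  qed
  moreover have "dual_value \<noteq> \<infinity>"
    using dual_value_lower(1) borel_probs_nonempty[OF K1(2)] by fastforce
  ultimately show ?thesis using that by (cases dual_value) auto
qed

text \<open>The two alternatives are equivalent: weak duality makes the dual value positive once
  something is feasible, and strong duality produces a feasible element from positivity. The first
  serves existence, the second the value formula.\<close>

lemma dual_value_minimizer:
  assumes "feasible M T X K1 K2 r \<noteq> {} \<or> 0 < dual_value"
  obtains H where "H \<in> feasible M T X K1 K2 r" "ereal (ip M H H) \<le> inverse dual_value"
proof -
  obtain m where m: "dual_value = ereal m" "0 \<le> m" by (rule dual_value_real)
  have "0 < m"
  proof (cases "feasible M T X K1 K2 r = {}")
    case True
    then show ?thesis using assms m by simp
  next
    case False
    then obtain H where H: "H \<in> feasible M T X K1 K2 r" by auto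
    have "ereal (1 / ip M H H) \<le> dual_value"
      by (intro dual_value_greatest feasible_bounds[OF H])
    then have "1 / ip M H H \<le> m" using m by simp
    moreover have "0 < 1 / ip M H H" using feasible_bounds(1)[OF H] by simp
    ultimately show ?thesis by (rule less_le_trans[rotated])
  qed
  moreover have "m \<le> dbl_int R \<mu> \<mu>" if "\<mu> \<in> borel_probs K1" for \<mu>
    using dual_value_lower(1)[OF that] m by simp
  moreover have "m \<le> A_term R \<mu> \<nu> / B_term R \<mu> \<nu> r" if "(\<mu>, \<nu>) \<in> nondegenerate_pairs R K1 K2 r" for \<mu> \<nu>
    using dual_value_lower(2)[OF that] m by simp
  ultimately obtain H where "H \<in> feasible M T X K1 K2 r" "ip M H H \<le> 1 / m"
    using strong_duality by metis
  then show ?thesis using that \<open>0 < m\<close> m by (simp add: inverse_eq_divide)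
qed

lemma inverse_dual_value_le:
  assumes H: "H \<in> feasible M T X K1 K2 r"
  shows "inverse dual_value \<le> ereal (ip M H H)"
proof -
  have "ereal (1 / ip M H H) \<le> dual_value"
    by (intro dual_value_greatest feasible_bounds[OF H])
  then have "inverse dual_value \<le> inverse (ereal (1 / ip M H H))"
    using feasible_bounds(1)[OF H] by (intro ereal_inverse_antimono) auto
  then show ?thesis using feasible_bounds(1)[OF H] by simp
qed

lemma D_value_eq: "D_value M T X K1 K2 r = inverse dual_value"
proof (rule antisym)
  show "inverse dual_value \<le> D_value M T X K1 K2 r"
    unfolding D_value_def ip_self[symmetric] by (intro INF_greatest inverse_dual_value_le)
  show "D_value M T X K1 K2 r \<le> inverse dual_value"
  proof (cases "0 < dual_value")
    case True
    then show ?thesis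
      using dual_value_minimizer unfolding D_value_def ip_self[symmetric] by (metis INF_lower2)
  next
    case False
    \<comment> \<open>\<open>inverse 0\<close> is infinite in \<open>ereal\<close>, so the upper
      bound is trivial here; together with the lower bound, the value is infinite and nothing is
      feasible.\<close>
    then have "dual_value = 0" using dual_value_real by (metis antisym_conv2 ereal_less_eq(5) not_less)
    then show ?thesis by simp
  qed
qed

text \<open>Uniqueness is strict convexity: the midpoint of two minimizers is feasible, and the
  parallelogram law turns the bound on its norm into a vanishing distance.\<close>

lemma minimizer_exists_unique:
  assumes ne: "feasible M T X K1 K2 r \<noteq> {}"
  obtains H where "H \<in> feasible M T X K1 K2 r" "ereal (ip M H H) = D_value M T X K1 K2 r"
    "\<And>H'. H' \<in> feasible M T X K1 K2 r \<Longrightarrow> ereal (ip M H' H') = D_value M T X K1 K2 r \<Longrightarrow> AE \<omega> in M. H' \<omega> = H \<omega>"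
proof -
  obtain H where H: "H \<in> feasible M T X K1 K2 r" and le: "ereal (ip M H H) \<le> inverse dual_value"
    using dual_value_minimizer ne by blast
  then have eq: "ereal (ip M H H) = D_value M T X K1 K2 r"
    using inverse_dual_value_le[OF H] by (simp add: D_value_eq antisym)
  have "AE \<omega> in M. H' \<omega> = H \<omega>"
    if H': "H' \<in> feasible M T X K1 K2 r" and eq': "ereal (ip M H' H') = D_value M T X K1 K2 r" for H'
  proof -
    have L: "H \<in> L2 M" "H' \<in> L2 M" using H H' ms_closure_L2 by (auto simp: feasible_def)
    let ?G = "\<lambda>\<omega>. 1/2 * H \<omega> + 1/2 * H' \<omega>"
    have G: "ip M (X t) ?G = 1/2 * ip M (X t) H + 1/2 * ip M (X t) H'" if "t \<in> T" for t
      using X_L2[OF that] L by (subst ip_add_right) (simp_all only: ip_scale_right L2_scale)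
    have "?G \<in> feasible M T X K1 K2 r"
      unfolding feasible_ip
    proof (intro conjI ballI)
      show "?G \<in> ms_closure M T X" using H H' by (intro ms_closure_lincomb) (auto simp: feasible_def)
      show "1 \<le> ip M (X t) ?G" if "t \<in> K1" for t
        unfolding G[OF subsetD[OF K1(3) that]] using H H' that by (force simp: feasible_ip)
      show "ip M (X t) ?G \<le> r" if "t \<in> K2" for t
        unfolding G[OF subsetD[OF K2(3) that]] using H H' that by (force simp: feasible_ip)
    qed
    then have "ereal (ip M H H) \<le> ereal (ip M ?G ?G)"
      using inverse_dual_value_le le order_trans by blast
    then have "ip M H H \<le> 1/4 * ip M H H + 1/2 * ip M H H' + 1/4 * ip M H' H'"
      unfolding ip_lincomb_self[OF L] by (simp add: power2_eq_square)
    moreover have "ip M H' H' = ip M H H" using eq eq' by (metis ereal.inject)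
    moreover have "ip M (\<lambda>\<omega>. H' \<omega> - H \<omega>) (\<lambda>\<omega>. H' \<omega> - H \<omega>) = ip M H' H' - 2 * ip M H H' + ip M H H"
      using L by (simp add: ip_linear ip_commute[of M H' H])
    ultimately have "ip M (\<lambda>\<omega>. H' \<omega> - H \<omega>) (\<lambda>\<omega>. H' \<omega> - H \<omega>) = 0"
      using ip_self_nonneg[of M "\<lambda>\<omega>. H' \<omega> - H \<omega>"] by linarith
    moreover have "integrable M (\<lambda>\<omega>. (H' \<omega> - H \<omega>)\<^sup>2)" using L2_diff[OF L(2,1)] by (simp add: L2_def)
    ultimately have "AE \<omega> in M. (H' \<omega> - H \<omega>)\<^sup>2 = 0"
      unfolding ip_self by (subst (asm) integral_nonneg_eq_0_iff_AE) auto
    then show ?thesis by simp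
  qed
  with H eq show ?thesis by (rule that)
qed

section \<open>Attainment of the two minima\<close>

lemma variance_minimizer:
  obtains \<mu> where "\<mu> \<in> borel_probs K1" "\<And>\<nu>. \<nu> \<in> borel_probs K1 \<Longrightarrow> dbl_int R \<mu> \<mu> \<le> dbl_int R \<nu> \<nu>"
proof -
  let ?f = "\<lambda>\<mu>. dbl_int R \<mu> \<mu>"
  \<comment> \<open>The measures are handled through their real image: weak sequential compactness
    and continuity of the double integral make the set of values compact.\<close>
  have "seq_compact (?f ` borel_probs K1)"
    unfolding seq_compact_def
  proof (intro allI impI)
    fix y :: "nat \<Rightarrow> real" assume "\<forall>n. y n \<in> ?f ` borel_probs K1"
    then obtain \<mu> where \<mu>: "\<And>n. \<mu> n \<in> borel_probs K1" and y: "\<And>n. y n = ?f (\<mu> n)"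
      unfolding image_iff by metis
    obtain \<mu>' s where \<mu>': "\<mu>' \<in> borel_probs K1" and s: "strict_mono s" and lim: "weak_tendsto K1 (\<lambda>n. \<mu> (s n)) \<mu>'"
      by (rule borel_probs_seq_compact[of K1 \<mu>, OF K1(1) \<mu>]) blast
    have "(\<lambda>n. ?f (\<mu> (s n))) \<longlonglongrightarrow> ?f \<mu>'"
      by (rule dbl_int_tendsto[OF K1(1) K1(1) continuous_on_R_subset[OF K1(3) K1(3)] \<mu> \<mu> \<mu>' lim lim])
    then show "\<exists>l\<in>?f ` borel_probs K1. \<exists>s. strict_mono s \<and> (y \<circ> s) \<longlonglongrightarrow> l"
      using \<mu>' s by (auto simp: comp_def y)
  qed
  then have "compact (?f ` borel_probs K1)" by (simp add: compact_eq_seq_compact_metric)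
  from compact_attains_inf[OF this] borel_probs_nonempty[OF K1(2)] show ?thesis
    using that by auto
qed

text \<open>Admissibility is closed under weak limits, so a limit of admissible pairs is admissible;
  \<open>nd\<close> then excludes a vanishing denominator in the limit, the only obstacle to
  continuity of the quotient.\<close>

lemma ratio_minimizer:
  assumes ne: "admissible_pairs R K1 K2 r \<noteq> {}"
    and nd: "nondegenerate_pairs R K1 K2 r = admissible_pairs R K1 K2 r"
  obtains \<mu> \<nu> where "(\<mu>, \<nu>) \<in> admissible_pairs R K1 K2 r"
    "\<And>\<mu>' \<nu>'. (\<mu>', \<nu>') \<in> admissible_pairs R K1 K2 r \<Longrightarrow>
       A_term R \<mu> \<nu> / B_term R \<mu> \<nu> r \<le> A_term R \<mu>' \<nu>' / B_term R \<mu>' \<nu>' r"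
proof -
  let ?P = "admissible_pairs R K1 K2 r"
  let ?f = "\<lambda>(\<mu>, \<nu>). A_term R \<mu> \<nu> / B_term R \<mu> \<nu> r"
  have "seq_compact (?f ` ?P)"
    unfolding seq_compact_def
  proof (intro allI impI)
    fix y :: "nat \<Rightarrow> real" assume "\<forall>n. y n \<in> ?f ` ?P"
    then have "\<forall>n. \<exists>p. p \<in> ?P \<and> y n = ?f p" by blast
    from choice[OF this] obtain \<pi> where \<pi>: "\<And>n. \<pi> n \<in> ?P" and y: "\<And>n. y n = ?f (\<pi> n)"
      by blast
    define \<mu> \<nu> where "\<mu> n = fst (\<pi> n)" and "\<nu> n = snd (\<pi> n)" for n
    have mem: "\<mu> n \<in> borel_probs K1" "\<nu> n \<in> borel_probs K2" and adm: "r * dbl_int R (\<mu> n) (\<mu> n) \<le> dbl_int R (\<mu> n) (\<nu> n)" for n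
      using \<pi>[of n] by (auto simp: \<mu>_def \<nu>_def admissible_pairs_def)
    obtain \<mu>' s1 where \<mu>': "\<mu>' \<in> borel_probs K1" and s1: "strict_mono s1" and lim1: "weak_tendsto K1 (\<lambda>n. \<mu> (s1 n)) \<mu>'"
      by (rule borel_probs_seq_compact[of K1 \<mu>, OF K1(1) mem(1)]) blast
    have mem2: "\<nu> (s1 n) \<in> borel_probs K2" for n by (rule mem(2))
    \<comment> \<open>The second measures converge along a further subsequence, along which the
      first ones still converge.\<close>
    obtain \<nu>' s2 where \<nu>': "\<nu>' \<in> borel_probs K2" and s2: "strict_mono s2" and lim2: "weak_tendsto K2 (\<lambda>n. \<nu> (s1 (s2 n))) \<nu>'"
      by (rule borel_probs_seq_compact[of K2 "\<lambda>n. \<nu> (s1 n)", OF K2(1) mem2]) blast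
    define s where "s = s1 \<circ> s2"
    have s: "strict_mono s" unfolding s_def using s1 s2 by (rule strict_mono_o)
    have l1: "weak_tendsto K1 (\<lambda>n. \<mu> (s n)) \<mu>'" and l2: "weak_tendsto K2 (\<lambda>n. \<nu> (s n)) \<nu>'"
      using weak_tendsto_subseq[OF lim1 s2] lim2 by (simp_all add: s_def)
    have lims: "(\<lambda>n. dbl_int R (\<mu> (s n)) (\<mu> (s n))) \<longlonglongrightarrow> dbl_int R \<mu>' \<mu>'"
        "(\<lambda>n. dbl_int R (\<mu> (s n)) (\<nu> (s n))) \<longlonglongrightarrow> dbl_int R \<mu>' \<nu>'"
        "(\<lambda>n. dbl_int R (\<nu> (s n)) (\<nu> (s n))) \<longlonglongrightarrow> dbl_int R \<nu>' \<nu>'"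
      by (rule dbl_int_tendsto[OF K1(1) K1(1) continuous_on_R_subset[OF K1(3) K1(3)] _ _ \<mu>' l1 l1]
          dbl_int_tendsto[OF K1(1) K2(1) continuous_on_R_subset[OF K1(3) K2(3)] _ _ \<nu>' l1 l2]
          dbl_int_tendsto[OF K2(1) K2(1) continuous_on_R_subset[OF K2(3) K2(3)] _ _ \<nu>' l2 l2]; rule mem)+
    have "r * dbl_int R \<mu>' \<mu>' \<le> dbl_int R \<mu>' \<nu>'"
      using adm by (intro LIMSEQ_le[OF tendsto_mult_left[OF lims(1)] lims(2)]) auto
    then have P': "(\<mu>', \<nu>') \<in> ?P" using \<mu>' \<nu>' by (simp add: admissible_pairs_def)
    then have "B_term R \<mu>' \<nu>' r \<noteq> 0" unfolding nd[symmetric] by (simp add: nondegenerate_pairs_def)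
    then have "(\<lambda>n. A_term R (\<mu> (s n)) (\<nu> (s n)) / B_term R (\<mu> (s n)) (\<nu> (s n)) r)
        \<longlonglongrightarrow> A_term R \<mu>' \<nu>' / B_term R \<mu>' \<nu>' r"
      unfolding A_term_def B_term_def by (intro tendsto_intros lims)
    then have "(y \<circ> s) \<longlonglongrightarrow> ?f (\<mu>', \<nu>')"
      by (simp add: comp_def y \<mu>_def \<nu>_def case_prod_beta)
    then show "\<exists>l\<in>?f ` ?P. \<exists>s. strict_mono s \<and> (y \<circ> s) \<longlonglongrightarrow> l"
      using P' s by blast
  qed
  then have "compact (?f ` ?P)" by (simp add: compact_eq_seq_compact_metric)
  then obtain y where "y \<in> ?f ` ?P" "\<forall>y'\<in>?f ` ?P. y \<le> y'"
    using compact_attains_inf[of "?f ` ?P"] ne by auto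
  then obtain \<mu> \<nu> where "(\<mu>, \<nu>) \<in> ?P" "\<forall>y'\<in>?f ` ?P. ?f (\<mu>, \<nu>) \<le> y'" by auto
  then show ?thesis using that by fastforce
qed

end

section \<open>Gaussian fields with continuous paths, and the theorem\<close>

lemma gaussian_l2_field:
  fixes X :: "'t::polish_space \<Rightarrow> 'a \<Rightarrow> real"
  assumes "prob_space M" and gauss: "gaussian_field M T X"
    and mean: "\<And>t. t \<in> T \<Longrightarrow> (\<integral>\<omega>. X t \<omega> \<partial>M) = 0"
    and cont: "\<And>\<omega>. \<omega> \<in> space M \<Longrightarrow> continuous_on T (\<lambda>t. X t \<omega>)"
    and K1: "compact K1" "K1 \<noteq> {}" "K1 \<subseteq> T"
    and K2: "compact K2" "K2 \<noteq> {}" "K2 \<subseteq> T"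
    and r: "0 < r"
  shows "l2_field M T X (cov_fun M X) K1 K2 r"
proof -
  interpret prob_space M by fact
  have T: "T \<noteq> {}" using K1 by auto
  have comb: "(\<lambda>\<omega>. \<Sum>x\<in>F. c x * X x \<omega>) \<in> finite_combinations T X" if "finite F" "F \<subseteq> T" for F c
    using that finite_combinations_iff[OF T] by blast
  have rv: "gaussian_rv M (X t)" if "t \<in> T" for t
    using comb[of "{t}" "\<lambda>_. 1"] that gauss by (simp add: gaussian_field_def)
  then have L: "X t \<in> L2 M" if "t \<in> T" for t using that gaussian_rv_L2 by blast
  have int: "integrable M (X t)" if "t \<in> T" for t
    using L[OF that] by (auto simp: L2_def intro: square_integrable_imp_integrable)
  have diff: "gaussian_rv M (\<lambda>\<omega>. X s \<omega> - X t \<omega>)" if "s \<in> T" "t \<in> T" for s t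
  \<comment> \<open>For \<open>s = t\<close> a coefficient function cannot assign 1 and -1 to the
    same point; the difference is then the constant 0, which counts as normal.\<close>
  proof (cases "s = t")
    case True
    then show ?thesis by (auto simp: gaussian_rv_def)
  next
    case False
    then show ?thesis
      using comb[of "{s, t}" "\<lambda>x. if x = s then 1 else -1"] that gauss by (simp add: gaussian_field_def)
  qed
  show ?thesis
  proof
    show "L2_tendsto M (\<lambda>n. X (u n)) (X t)" if u: "\<And>n. u n \<in> T" and t: "t \<in> T" and lim: "u \<longlonglongrightarrow> t" for u t
    proof (rule gaussian_L2_tendsto)
      show "expectation (\<lambda>\<omega>. X (u n) \<omega> - X t \<omega>) = 0" for n
        using int[OF u] int[OF t] mean u t by simp
      show "(\<lambda>n. X (u n) \<omega>) \<longlonglongrightarrow> X t \<omega>" if "\<omega> \<in> space M" for \<omega>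
        using cont[OF that] u t lim by (simp add: continuous_on_sequentially comp_def)
    qed (rule diff[OF u t])
    show "cov_fun M X s t = ip M (X s) (X t)" if "s \<in> T" "t \<in> T" for s t
      using that mean by (simp add: cov_fun_def covariance_def ip_def)
  qed (use L K1 K2 r in auto)
qed

theorem theorem2p3:
  fixes M :: "'a measure"
    and X :: "real ^ 'd \<Rightarrow> 'a \<Rightarrow> real"
    and T K1 K2 :: "(real ^ 'd) set"
    and R :: "real ^ 'd \<Rightarrow> real ^ 'd \<Rightarrow> real"
    and r :: real
  assumes "prob_space M"
    and "compact T"
    and "gaussian_field M T X"
    and "\<And>t. t \<in> T \<Longrightarrow> (\<integral>\<omega>. X t \<omega> \<partial>M) = 0"
    and "\<And>\<omega>. \<omega> \<in> space M \<Longrightarrow> continuous_on T (\<lambda>t. X t \<omega>)"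
    and "R = cov_fun M X"
    and "compact K1" "K1 \<noteq> {}" "K1 \<subseteq> T"
    and "compact K2" "K2 \<noteq> {}" "K2 \<subseteq> T"
    and "r > 0"
  shows
    "(feasible M T X K1 K2 r \<noteq> {} \<longrightarrow>
       (\<exists>H\<in>feasible M T X K1 K2 r.
          ereal (\<integral>\<omega>. (H \<omega>)\<^sup>2 \<partial>M) = D_value M T X K1 K2 r \<and>
          (\<forall>H'\<in>feasible M T X K1 K2 r.
             ereal (\<integral>\<omega>. (H' \<omega>)\<^sup>2 \<partial>M) = D_value M T X K1 K2 r \<longrightarrow> (AE \<omega> in M. H' \<omega> = H \<omega>))))
     \<and>
     D_value M T X K1 K2 r =
       inverse (min
         (INF \<mu>\<^sub>1\<in>borel_probs K1. ereal (dbl_int R \<mu>\<^sub>1 \<mu>\<^sub>1))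
         (INF (\<mu>\<^sub>1, \<mu>\<^sub>2)\<in>nondegenerate_pairs R K1 K2 r.
            ereal (A_term R \<mu>\<^sub>1 \<mu>\<^sub>2 / B_term R \<mu>\<^sub>1 \<mu>\<^sub>2 r)))
     \<and>
     (\<exists>\<mu>\<^sub>1\<in>borel_probs K1. \<forall>\<nu>\<^sub>1\<in>borel_probs K1. dbl_int R \<mu>\<^sub>1 \<mu>\<^sub>1 \<le> dbl_int R \<nu>\<^sub>1 \<nu>\<^sub>1)
     \<and>
     (admissible_pairs R K1 K2 r \<noteq> {} \<and>
      nondegenerate_pairs R K1 K2 r = admissible_pairs R K1 K2 r \<longrightarrow>
       (\<exists>(\<mu>\<^sub>1, \<mu>\<^sub>2)\<in>admissible_pairs R K1 K2 r.
          \<forall>(\<nu>\<^sub>1, \<nu>\<^sub>2)\<in>admissible_pairs R K1 K2 r.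
            A_term R \<mu>\<^sub>1 \<mu>\<^sub>2 / B_term R \<mu>\<^sub>1 \<mu>\<^sub>2 r \<le> A_term R \<nu>\<^sub>1 \<nu>\<^sub>2 / B_term R \<nu>\<^sub>1 \<nu>\<^sub>2 r))"
proof -
  interpret l2_field M T X R K1 K2 r
    unfolding \<open>R = cov_fun M X\<close> using assms by (intro gaussian_l2_field)
  show ?thesis
  proof (intro conjI impI)
    assume "feasible M T X K1 K2 r \<noteq> {}"
    then obtain H where "H \<in> feasible M T X K1 K2 r" "ereal (ip M H H) = D_value M T X K1 K2 r"
      "\<And>H'. H' \<in> feasible M T X K1 K2 r \<Longrightarrow> ereal (ip M H' H') = D_value M T X K1 K2 r \<Longrightarrow> AE \<omega> in M. H' \<omega> = H \<omega>"
      by (rule minimizer_exists_unique) blast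
    then show "\<exists>H\<in>feasible M T X K1 K2 r.
          ereal (\<integral>\<omega>. (H \<omega>)\<^sup>2 \<partial>M) = D_value M T X K1 K2 r \<and>
          (\<forall>H'\<in>feasible M T X K1 K2 r.
             ereal (\<integral>\<omega>. (H' \<omega>)\<^sup>2 \<partial>M) = D_value M T X K1 K2 r \<longrightarrow> (AE \<omega> in M. H' \<omega> = H \<omega>))"
      unfolding ip_self by blast
  next
    show "\<exists>\<mu>\<^sub>1\<in>borel_probs K1. \<forall>\<nu>\<^sub>1\<in>borel_probs K1. dbl_int R \<mu>\<^sub>1 \<mu>\<^sub>1 \<le> dbl_int R \<nu>\<^sub>1 \<nu>\<^sub>1"
      by (rule variance_minimizer) blast
  next
    assume "admissible_pairs R K1 K2 r \<noteq> {} \<and> nondegenerate_pairs R K1 K2 r = admissible_pairs R K1 K2 r"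
    then have ne: "admissible_pairs R K1 K2 r \<noteq> {}"
      and nd: "nondegenerate_pairs R K1 K2 r = admissible_pairs R K1 K2 r" by auto
    obtain \<mu> \<nu> where "(\<mu>, \<nu>) \<in> admissible_pairs R K1 K2 r"
      "\<And>\<mu>' \<nu>'. (\<mu>', \<nu>') \<in> admissible_pairs R K1 K2 r \<Longrightarrow>
         A_term R \<mu> \<nu> / B_term R \<mu> \<nu> r \<le> A_term R \<mu>' \<nu>' / B_term R \<mu>' \<nu>' r"
      by (rule ratio_minimizer[OF ne nd]) blast
    then show "\<exists>(\<mu>\<^sub>1, \<mu>\<^sub>2)\<in>admissible_pairs R K1 K2 r.
          \<forall>(\<nu>\<^sub>1, \<nu>\<^sub>2)\<in>admissible_pairs R K1 K2 r.
            A_term R \<mu>\<^sub>1 \<mu>\<^sub>2 / B_term R \<mu>\<^sub>1 \<mu>\<^sub>2 r \<le> A_term R \<nu>\<^sub>1 \<nu>\<^sub>2 / B_term R \<nu>\<^sub>1 \<nu>\<^sub>2 r"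
      by blast
  qed (rule D_value_eq[unfolded dual_value_def])
qed

end
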